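(* $\mathbf{FQSym}^{(\ell)}$, endowed with the coproduct $\Delta f(\boldsymbol{A})=f(\boldsymbol{A}'\oplus\boldsymbol{A}'')$, is a graded connected bialgebra; hence it is a Hopf algebra. The coproduct is given by $$\Delta\mathbf{G}_{\sigma,u}=\sum_{\substack{(\sigma',u'),(\sigma'',u'')\\ (\sigma,u)\in(\sigma',u')\Cup(\sigma'',u'')}}\mathbf{G}_{\sigma',u'}\otimes\mathbf{G}_{\sigma'',u''}$$ for every colored permutation $(\sigma,u)$, the sum being over pairs of colored permutations (including the empty one).
   Context: Let $C$ be a set of $\ell$ colors, $A=\{1<2<3<\cdots\}$, and $\boldsymbol{A}=A\times C$. A word of length $n$ over $\boldsymbol{A}$ is written $(v,u)$ with $v\in A^n$, $u\in C^n$. $\mathrm{Std}(v)\in\mathfrak{S}_n$ denotes the standardization of $v$ (the permutation having the same inversions as $v$); it makes sense over any totally ordered alphabet. Put $\mathbf{Std}(v,u)=(\mathrm{Std}(v),u)$. A colored permutation of size $n$ is a pair $(\sigma,u)$ with $\sigma\in\mathfrak{S}_n$, $u\in C^n$, and $$\mathbf{G}_{\sigma,u}=\mathbf{G}_{\sigma,u}(\boldsymbol{A})=\sum_{w\in\boldsymbol{A}^n,\ \mathbf{Std}(w)=(\sigma,u)}w$$ (infinite formal sums of words of bounded degree are allowed). $\mathbf{FQSym}^{(\ell)}$ is the algebra spanned by all the $\mathbf{G}_{\sigma,u}$, graded by size. Coproduct: let $A',A''$ be two isomorphic copies of the ordered set $A$, let $A'\oplus A''$ be their ordered sum (every element of $A'$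 is smaller than every element of $A''$), and let $\boldsymbol{A}'\oplus\boldsymbol{A}''=(A'\oplus A'')\times C$. Assuming that the letters of $\boldsymbol{A}'=A'\times C$ commute with those of $\boldsymbol{A}''=A''\times C$, identify $f(\boldsymbol{A}')g(\boldsymbol{A}'')$ with $f\otimes g$ and set $\Delta f(\boldsymbol{A})=f(\boldsymbol{A}'\oplus\boldsymbol{A}'')$. Shifted shuffle: for a colored word $(v,u)$ and integer $k$, $(v,u)[k]$ is obtained by adding $k$ to every letter of $v$, keeping colors. The shifted shuffle $(\sigma',u')\Cup(\sigma'',u'')$ is the ordinary shuffle of the words of biletters $(\sigma',u')$ and $(\sigma'',u'')[k]$, where $k$ is the length of $\sigma'$ (each color follows the letter to which it is attached). *)

theory Defs
  imports
    Complex_Main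
    "HOL-Library.Function_Algebras"
    "HOL-Library.Product_Lexorder"
    "HOL-Combinatorics.Multiset_Permutations"
begin

section \<open>Vector spaces of functions and their tensor products\<close>

text \<open>
  A formal sum of elements of a set @X@ with coefficients in @k@ is a function from @X@ to @k@;
  all vector spaces below are subspaces of such function spaces.  For subspaces @V@ and @W@ of
  @k^X@ and @k^Y@, the canonical map from the tensor product of @V@ and @W@ to @k^(X * Y)@ is
  injective, so the tensor product is realized as the span of the functions @(x,y) -> f x * g y@.
\<close>

definition fscale :: "'k::field \<Rightarrow> ('x \<Rightarrow> 'k) \<Rightarrow> 'x \<Rightarrow> 'k" where
  "fscale c f = (\<lambda>x. c * f x)"

global_interpretation fun_vs: vector_space "fscale :: 'k::field \<Rightarrow> ('x \<Rightarrow> 'k) \<Rightarrow> 'x \<Rightarrow> 'k"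
  by unfold_locales (simp_all add: fscale_def fun_eq_iff algebra_simps)

definition linear_on ::
  "('x \<Rightarrow> 'k::field) set \<Rightarrow> ('k \<Rightarrow> 'z \<Rightarrow> 'z) \<Rightarrow> (('x \<Rightarrow> 'k) \<Rightarrow> 'z::ab_group_add) \<Rightarrow> bool" where
  "linear_on V s \<phi> \<longleftrightarrow>
     (\<forall>f\<in>V. \<forall>g\<in>V. \<phi> (f + g) = \<phi> f + \<phi> g) \<and> (\<forall>c. \<forall>f\<in>V. \<phi> (fscale c f) = s c (\<phi> f))"

definition tens :: "('x \<Rightarrow> 'k::field) \<Rightarrow> ('y \<Rightarrow> 'k) \<Rightarrow> ('x \<times> 'y \<Rightarrow> 'k)" where
  "tens f g = (\<lambda>(x, y). f x * g y)"

definition tensor_space ::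
  "('x \<Rightarrow> 'k::field) set \<Rightarrow> ('y \<Rightarrow> 'k) set \<Rightarrow> ('x \<times> 'y \<Rightarrow> 'k) set" where
  "tensor_space V W = fun_vs.span {tens f g | f g. f \<in> V \<and> g \<in> W}"

definition tsum :: "(('x \<Rightarrow> 'k::field) \<times> ('y \<Rightarrow> 'k)) list \<Rightarrow> ('x \<times> 'y \<Rightarrow> 'k)" where
  "tsum ps = (\<Sum>(f, g)\<leftarrow>ps. tens f g)"

text \<open>
  The linear map on the tensor product of @V@ and @W@ induced by a bilinear map @\<beta>@; by lemma
  @tlift_tsum@ below it exists and has the expected values.
\<close>

definition tlift ::
  "('x \<Rightarrow> 'k::field) set \<Rightarrow> ('y \<Rightarrow> 'k) set \<Rightarrow>
   (('x \<Rightarrow> 'k) \<Rightarrow> ('y \<Rightarrow> 'k) \<Rightarrow> 'z::ab_group_add) \<Rightarrow> ('x \<times> 'y \<Rightarrow> 'k) \<Rightarrow> 'z" where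
  "tlift V W \<beta> F =
     (THE z. \<forall>ps \<in> lists (V \<times> W). F = tsum ps \<longrightarrow> z = (\<Sum>(f, g)\<leftarrow>ps. \<beta> f g))"

definition tensor_map ::
  "('x \<Rightarrow> 'k::field) set \<Rightarrow> ('y \<Rightarrow> 'k) set \<Rightarrow>
   (('x \<Rightarrow> 'k) \<Rightarrow> ('x' \<Rightarrow> 'k)) \<Rightarrow> (('y \<Rightarrow> 'k) \<Rightarrow> ('y' \<Rightarrow> 'k)) \<Rightarrow>
   ('x \<times> 'y \<Rightarrow> 'k) \<Rightarrow> ('x' \<times> 'y' \<Rightarrow> 'k)" where
  "tensor_map V W \<phi> \<psi> = tlift V W (\<lambda>f g. tens (\<phi> f) (\<psi> g))"

definition bilinear_on ::
  "('x \<Rightarrow> 'k::field) set \<Rightarrow> ('y \<Rightarrow> 'k) set \<Rightarrow> ('k \<Rightarrow> 'z \<Rightarrow> 'z) \<Rightarrow>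
   (('x \<Rightarrow> 'k) \<Rightarrow> ('y \<Rightarrow> 'k) \<Rightarrow> 'z::ab_group_add) \<Rightarrow> bool" where
  "bilinear_on V W s \<beta> \<longleftrightarrow>
     (\<forall>g\<in>W. linear_on V s (\<lambda>f. \<beta> f g)) \<and> (\<forall>f\<in>V. linear_on W s (\<beta> f))"

lemma linear_on_zero:
  assumes "linear_on V s \<phi>" "fun_vs.subspace V"
  shows "\<phi> 0 = 0"
proof -
  have "\<phi> (0 + 0) = \<phi> 0 + \<phi> 0"
    using assms fun_vs.subspace_0 unfolding linear_on_def by blast
  then show ?thesis by simp
qed

lemma bilinear_on_tens: "bilinear_on V W fscale tens"
  by (auto simp: bilinear_on_def linear_on_def tens_def fscale_def fun_eq_iff algebra_simps)

lemma bilinear_on_shift: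
  assumes \<beta>: "bilinear_on V W s \<beta>" and V: "fun_vs.subspace V" and W: "fun_vs.subspace W"
    and b: "b \<in> W" and ps: "ps \<in> lists (V \<times> W)"
  shows "(\<Sum>(f, g)\<leftarrow>ps. fscale (r g) f) \<in> V \<and>
    (\<Sum>(f, g)\<leftarrow>ps. \<beta> f (g + fscale (- r g) b)) =
    (\<Sum>(f, g)\<leftarrow>ps. \<beta> f g) + \<beta> (\<Sum>(f, g)\<leftarrow>ps. fscale (r g) f) (fscale (- 1) b)"
  using ps
proof (induction ps rule: list.induct)
  case Nil
  have "fscale (- 1) b \<in> W" using b W by (simp add: fun_vs.subspace_scale fun_vs.subspace_neg)
  then have "\<beta> 0 (fscale (- 1) b) = 0"
    using \<beta> V linear_on_zero unfolding bilinear_on_def by blast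
  then show ?case using fun_vs.subspace_0[OF V] by (simp add: zero_fun_def fun_Compl_def)
next
  case (Cons p ps)
  obtain f g where p: "p = (f, g)" "f \<in> V" "g \<in> W" using Cons.prems by auto
  let ?S = "\<Sum>(f, g)\<leftarrow>ps. fscale (r g) f"
  let ?b = "fscale (- 1) b"
  have "ps \<in> lists (V \<times> W)" using Cons.prems by simp
  with Cons.IH have S: "?S \<in> V"
    and IH: "(\<Sum>(f, g)\<leftarrow>ps. \<beta> f (g + fscale (- r g) b)) = (\<Sum>(f, g)\<leftarrow>ps. \<beta> f g) + \<beta> ?S ?b"
    by blast+
  have b': "?b \<in> W" "fscale (- r g) b \<in> W" using b W by (simp_all add: fun_vs.subspace_scale fun_vs.subspace_neg)
  have rf: "fscale (r g) f \<in> V" using p V by (simp add: fun_vs.subspace_scale fun_vs.subspace_neg)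
  have e: "fscale (- r g) b = fscale (r g) ?b" by (simp add: fscale_def)
  have "\<beta> f (g + fscale (- r g) b) = \<beta> f g + \<beta> f (fscale (- r g) b)"
    using \<beta> p b' unfolding bilinear_on_def linear_on_def by blast
  also have "\<beta> f (fscale (- r g) b) = s (r g) (\<beta> f ?b)"
    using \<beta> p b' unfolding bilinear_on_def linear_on_def e by blast
  also have "\<dots> = \<beta> (fscale (r g) f) ?b"
    using \<beta> p b' unfolding bilinear_on_def linear_on_def by simp
  finally have 1: "\<beta> f (g + fscale (- r g) b) = \<beta> f g + \<beta> (fscale (r g) f) ?b" .
  have 2: "\<beta> (fscale (r g) f + ?S) ?b = \<beta> (fscale (r g) f) ?b + \<beta> ?S ?b"
    using \<beta> S rf b' unfolding bilinear_on_def linear_on_def by blast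
  show ?case
    using fun_vs.subspace_add[OF V rf S] IH 1 2
    unfolding p(1) list.map sum_list.Cons prod.case by (simp only: add_ac simp_thms)
qed

lemma bilinear_on_tsum_zero:
  fixes V :: "('x \<Rightarrow> 'k::field) set" and W :: "('y \<Rightarrow> 'k) set"
  assumes \<beta>: "bilinear_on V W s \<beta>" and V: "fun_vs.subspace V" and W: "fun_vs.subspace W"
    and "ps \<in> lists (V \<times> W)" and "tsum ps = 0"
  shows "(\<Sum>(f, g)\<leftarrow>ps. \<beta> f g) = 0"
  using assms(4,5)
proof (induction "length ps" arbitrary: ps)
  case 0
  then show ?case by simp
next
  case (Suc n)
  then obtain a b qs where ps: "ps = (a, b) # qs" "a \<in> V" "b \<in> W" "qs \<in> lists (V \<times> W)"
    by (cases ps) auto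
  have n: "n = length qs" using Suc ps by simp
  show ?case
  proof (cases "b = 0")
    case True
    have "\<beta> a 0 = 0"
      using \<beta> W ps linear_on_zero unfolding bilinear_on_def by blast
    moreover have "tens a (0 :: 'y \<Rightarrow> 'k) = 0" by (auto simp: tens_def)
    ultimately show ?thesis
      using Suc.hyps(1)[OF n ps(4)] Suc.prems ps True by (simp add: tsum_def)
  next
    case False
    then obtain y where y: "b y \<noteq> 0" by (auto simp: fun_eq_iff)
    define r where "r g = g y / b y" for g :: "'y \<Rightarrow> 'k"
    let ?S = "\<Sum>(f, g)\<leftarrow>qs. fscale (r g) f"
    define rs where "rs = map (\<lambda>(f, g). (f, g + fscale (- r g) b)) qs"
    have sum_rs: "(\<Sum>(f, g)\<leftarrow>rs. \<gamma> f g) = (\<Sum>(f, g)\<leftarrow>qs. \<gamma> f (g + fscale (- r g) b))"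
      for \<gamma> :: "('x \<Rightarrow> 'k) \<Rightarrow> ('y \<Rightarrow> 'k) \<Rightarrow> 'w::ab_group_add"
      unfolding rs_def by (simp add: split_beta' comp_def)
    have "g + fscale (- r g) b \<in> W" if "g \<in> W" for g
      using that W ps by (intro fun_vs.subspace_add fun_vs.subspace_scale fun_vs.subspace_neg) auto
    then have rs: "rs \<in> lists (V \<times> W)" using ps(4) by (fastforce simp: rs_def)
    have ev: "(\<Sum>(f, g)\<leftarrow>xs. \<gamma> f g) z = (\<Sum>(f, g)\<leftarrow>xs. \<gamma> f g z)"
      for xs :: "(('x \<Rightarrow> 'k) \<times> ('y \<Rightarrow> 'k)) list" and \<gamma> :: "_ \<Rightarrow> _ \<Rightarrow> 'w \<Rightarrow> 'k" and z
      by (induction xs) auto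
    have a: "?S = fscale (- 1) a"
    proof
      fix x
      have "0 = tsum ps (x, y)" using Suc.prems by simp
      also have "\<dots> = a x * b y + (\<Sum>(f, g)\<leftarrow>qs. f x * g y)"
        unfolding ps tsum_def by (simp add: ev tens_def)
      also have "(\<Sum>(f, g)\<leftarrow>qs. f x * g y) = b y * (\<Sum>(f, g)\<leftarrow>qs. r g * f x)"
        using y by (induction qs) (auto simp: r_def algebra_simps)
      also have "(\<Sum>(f, g)\<leftarrow>qs. r g * f x) = ?S x" by (simp add: ev fscale_def)
      finally have "b y * (a x + ?S x) = 0" by (simp add: algebra_simps)
      then show "?S x = fscale (- 1) a x"
        using y by (simp add: fscale_def add_eq_0_iff)
    qed
    have b': "fscale (- 1) b \<in> W" using ps W by (simp add: fun_vs.subspace_scale fun_vs.subspace_neg)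
    have "\<beta> (fscale (- 1) a) (fscale (- 1) b) = s (- 1) (\<beta> a (fscale (- 1) b))"
      using \<beta> ps b' unfolding bilinear_on_def linear_on_def by blast
    also have "\<dots> = \<beta> a (fscale (- 1) (fscale (- 1) b))"
      using \<beta> ps b' unfolding bilinear_on_def linear_on_def by metis
    finally have 1: "\<beta> (fscale (- 1) a) (fscale (- 1) b) = \<beta> a b" by (simp add: fscale_def)
    have t: "tens (fscale (- 1) a) (fscale (- 1) b) = tens a b"
      by (auto simp: tens_def fscale_def)
    have "tsum rs = tsum qs + tens a b"
      using bilinear_on_shift[OF bilinear_on_tens V W ps(3,4), of r]
      unfolding tsum_def sum_rs a t by simp
    then have "tsum rs = 0" using Suc.prems ps by (simp add: tsum_def add.commute)
    then have "(\<Sum>(f, g)\<leftarrow>rs. \<beta> f g) = 0"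
      using Suc.hyps(1)[of rs] n rs by (simp add: rs_def)
    moreover have "(\<Sum>(f, g)\<leftarrow>rs. \<beta> f g) = (\<Sum>(f, g)\<leftarrow>qs. \<beta> f g) + \<beta> a b"
      using bilinear_on_shift[OF \<beta> V W ps(3,4), of r]
      unfolding sum_rs a 1 by simp
    ultimately show ?thesis using ps by (simp add: add.commute)
  qed
qed

lemma tlift_tsum:
  assumes \<beta>: "bilinear_on V W s \<beta>" and V: "fun_vs.subspace V" and W: "fun_vs.subspace W"
    and ps: "ps \<in> lists (V \<times> W)"
  shows "tlift V W \<beta> (tsum ps) = (\<Sum>(f, g)\<leftarrow>ps. \<beta> f g)"
  unfolding tlift_def
proof (rule the1_equality', rule Uniq_I)
  fix z z'
  assume "\<forall>qs\<in>lists (V \<times> W). tsum ps = tsum qs \<longrightarrow> z = (\<Sum>(f, g)\<leftarrow>qs. \<beta> f g)"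
    and "\<forall>qs\<in>lists (V \<times> W). tsum ps = tsum qs \<longrightarrow> z' = (\<Sum>(f, g)\<leftarrow>qs. \<beta> f g)"
  then show "z = z'" using ps by simp
next
  show "\<forall>qs\<in>lists (V \<times> W). tsum ps = tsum qs \<longrightarrow>
          (\<Sum>(f, g)\<leftarrow>ps. \<beta> f g) = (\<Sum>(f, g)\<leftarrow>qs. \<beta> f g)"
  proof (intro ballI impI)
    fix qs assume qs: "qs \<in> lists (V \<times> W)" and eq: "tsum ps = tsum qs"
    let ?ns = "map (\<lambda>(f, g). (fscale (- 1) f, g)) ps"
    have ns: "?ns \<in> lists (V \<times> W)" using ps V by (fastforce simp: fun_vs.subspace_scale fun_vs.subspace_neg)
    have neg: "(\<Sum>(f, g)\<leftarrow>?ns. \<gamma> f g) = - (\<Sum>(f, g)\<leftarrow>ps. \<gamma> f g)"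
      if \<gamma>: "bilinear_on V W t \<gamma>"
      for t and \<gamma> :: "_ \<Rightarrow> _ \<Rightarrow> 'w::ab_group_add"
      using ps
    proof (induction ps rule: list.induct)
      case (Cons p ps)
      obtain f g where p: "p = (f, g)" "f \<in> V" "g \<in> W" using Cons.prems by auto
      have f': "fscale (- 1) f \<in> V" using p V by (simp add: fun_vs.subspace_scale fun_vs.subspace_neg)
      have lin: "linear_on V t (\<lambda>f. \<gamma> f g)" using \<gamma> p unfolding bilinear_on_def by blast
      have "fscale (- 1) f + f = 0" by (simp add: fscale_def fun_eq_iff)
      then have "0 = \<gamma> (fscale (- 1) f + f) g" using linear_on_zero[OF lin V] by simp
      also have "\<dots> = \<gamma> (fscale (- 1) f) g + \<gamma> f g"
        using lin f' p unfolding linear_on_def by blast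
      finally have "\<gamma> (fscale (- 1) f) g = - \<gamma> f g" by (simp add: eq_neg_iff_add_eq_0)
      then show ?case using Cons p by (simp add: fun_Compl_def)
    qed simp
    have "tsum (?ns @ qs) = - tsum ps + tsum qs"
      using neg[OF bilinear_on_tens] by (simp add: tsum_def)
    then have "tsum (?ns @ qs) = 0" using eq by simp
    then have "(\<Sum>(f, g)\<leftarrow>?ns @ qs. \<beta> f g) = 0"
      using bilinear_on_tsum_zero[OF \<beta> V W, of "?ns @ qs"] ns qs by simp
    then have "- (\<Sum>(f, g)\<leftarrow>ps. \<beta> f g) + (\<Sum>(f, g)\<leftarrow>qs. \<beta> f g) = 0"
      using neg[OF \<beta>] by simp
    then show "(\<Sum>(f, g)\<leftarrow>ps. \<beta> f g) = (\<Sum>(f, g)\<leftarrow>qs. \<beta> f g)"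
      by (simp add: eq_neg_iff_add_eq_0 add.commute)
  qed
qed


section \<open>Graded connected bialgebras and Hopf algebras\<close>

locale fun_algebra =
  fixes H :: "('x \<Rightarrow> 'k::field) set"
    and mul :: "('x \<Rightarrow> 'k) \<Rightarrow> ('x \<Rightarrow> 'k) \<Rightarrow> ('x \<Rightarrow> 'k)"
    and unit :: "'x \<Rightarrow> 'k"
  assumes subspace: "fun_vs.subspace H"
    and mult_closed: "f \<in> H \<Longrightarrow> g \<in> H \<Longrightarrow> mul f g \<in> H"
    and mult_bilinear: "bilinear_on H H fscale mul"
    and mult_assoc: "f \<in> H \<Longrightarrow> g \<in> H \<Longrightarrow> h \<in> H \<Longrightarrow> mul (mul f g) h = mul f (mul g h)"
    and unit_closed: "unit \<in> H"
    and unit_left: "f \<in> H \<Longrightarrow> mul unit f = f"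
    and unit_right: "f \<in> H \<Longrightarrow> mul f unit = f"

locale fun_coalgebra =
  fixes H :: "('x \<Rightarrow> 'k::field) set"
    and comult :: "('x \<Rightarrow> 'k) \<Rightarrow> ('x \<times> 'x \<Rightarrow> 'k)"
    and counit :: "('x \<Rightarrow> 'k) \<Rightarrow> 'k"
  assumes subspace: "fun_vs.subspace H"
    and comult_closed: "f \<in> H \<Longrightarrow> comult f \<in> tensor_space H H"
    and comult_linear: "linear_on H fscale comult"
    and counit_linear: "linear_on H (*) counit"
    and coassoc: "f \<in> H \<Longrightarrow>
      tensor_map H H comult id (comult f) =
      (\<lambda>((x, y), z). tensor_map H H id comult (comult f) (x, (y, z)))"
    and counit_left: "f \<in> H \<Longrightarrow> tlift H H (\<lambda>a b. fscale (counit a) b) (comult f) = f"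
    and counit_right: "f \<in> H \<Longrightarrow> tlift H H (\<lambda>a b. fscale (counit b) a) (comult f) = f"

definition tensor_mult ::
  "('x \<Rightarrow> 'k::field) set \<Rightarrow> (('x \<Rightarrow> 'k) \<Rightarrow> ('x \<Rightarrow> 'k) \<Rightarrow> ('x \<Rightarrow> 'k)) \<Rightarrow>
   ('x \<times> 'x \<Rightarrow> 'k) \<Rightarrow> ('x \<times> 'x \<Rightarrow> 'k) \<Rightarrow> ('x \<times> 'x \<Rightarrow> 'k)" where
  "tensor_mult H mul F G =
     tlift H H (\<lambda>a b. tlift H H (\<lambda>c d. tens (mul a c) (mul b d)) G) F"

locale fun_bialgebra =
  fun_algebra H mul unit + fun_coalgebra H comult counit
  for H :: "('x \<Rightarrow> 'k::field) set" and mul unit comult counit +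
  assumes comult_mult: "f \<in> H \<Longrightarrow> g \<in> H \<Longrightarrow>
      comult (mul f g) = tensor_mult H mul (comult f) (comult g)"
    and comult_unit: "comult unit = tens unit unit"
    and counit_mult: "f \<in> H \<Longrightarrow> g \<in> H \<Longrightarrow> counit (mul f g) = counit f * counit g"
    and counit_unit: "counit unit = 1"

locale graded_connected_bialgebra =
  fun_bialgebra H mul unit comult counit
  for H :: "('x \<Rightarrow> 'k::field) set" and Hn :: "nat \<Rightarrow> ('x \<Rightarrow> 'k) set"
    and mul unit comult counit +
  assumes hom_subspace: "fun_vs.subspace (Hn n)"
    and hom_span: "H = fun_vs.span (\<Union>n. Hn n)"
    and hom_independent:
      "(\<And>n. h n \<in> Hn n) \<Longrightarrow> finite N \<Longrightarrow> (\<Sum>n\<in>N. h n) = 0 \<Longrightarrow> n \<in> N \<Longrightarrow> h n = 0"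
    and mult_graded: "f \<in> Hn m \<Longrightarrow> g \<in> Hn n \<Longrightarrow> mul f g \<in> Hn (m + n)"
    and unit_graded: "unit \<in> Hn 0"
    and comult_graded: "f \<in> Hn n \<Longrightarrow>
      comult f \<in> fun_vs.span (\<Union>i\<le>n. {tens a b | a b. a \<in> Hn i \<and> b \<in> Hn (n - i)})"
    and counit_graded: "f \<in> Hn n \<Longrightarrow> n > 0 \<Longrightarrow> counit f = 0"
    and connected: "Hn 0 = fun_vs.span {unit}"

locale fun_Hopf_algebra =
  fun_bialgebra H mul unit comult counit
  for H :: "('x \<Rightarrow> 'k::field) set" and mul unit comult counit +
  fixes antipode :: "('x \<Rightarrow> 'k) \<Rightarrow> ('x \<Rightarrow> 'k)"
  assumes antipode_closed: "f \<in> H \<Longrightarrow> antipode f \<in> H"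
    and antipode_linear: "linear_on H fscale antipode"
    and antipode_left: "f \<in> H \<Longrightarrow>
      tlift H H (\<lambda>a b. mul (antipode a) b) (comult f) = fscale (counit f) unit"
    and antipode_right: "f \<in> H \<Longrightarrow>
      tlift H H (\<lambda>a b. mul a (antipode b)) (comult f) = fscale (counit f) unit"


section \<open>Colored words and colored permutations\<close>

text \<open>
  The colored word @(v,u)@ is the list of its biletters, @v@ and @u@ being the images under
  @map fst@ and @map snd@.
\<close>

type_synonym ('a, 'c) cword = "('a \<times> 'c) list"

text \<open>A permutation of size @n@ is given by the list of its values.\<close>

definition std :: "'a::linorder list \<Rightarrow> nat list" where
  "std v = (THE \<sigma>. \<sigma> \<in> permutations_of_set {1..length v} \<and>
     (\<forall>j<length v. \<forall>i<j. \<sigma> ! i > \<sigma> ! j \<longleftrightarrow> v ! i > v ! j))"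

definition cstd :: "('a::linorder, 'c) cword \<Rightarrow> (nat, 'c) cword" where
  "cstd w = zip (std (map fst w)) (map snd w)"

definition colored_perms_of_size :: "'c set \<Rightarrow> nat \<Rightarrow> (nat, 'c) cword set" where
  "colored_perms_of_size C n =
     {p. map fst p \<in> permutations_of_set {1..n} \<and> set (map snd p) \<subseteq> C}"

definition colored_perms :: "'c set \<Rightarrow> (nat, 'c) cword set" where
  "colored_perms C = (\<Union>n. colored_perms_of_size C n)"

definition shift :: "nat \<Rightarrow> (nat, 'c) cword \<Rightarrow> (nat, 'c) cword" where
  "shift k w = map (\<lambda>(a, c). (a + k, c)) w"

text \<open>
  The biletters of the two shuffled words are different, so no word occurs twice in the shuffle
  and the latter is a set.
\<close>

definition shifted_shuffle :: "(nat, 'c) cword \<Rightarrow> (nat, 'c) cword \<Rightarrow> (nat, 'c) cword set" where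
  "shifted_shuffle p q = shuffles p (shift (length p) q)"


section \<open>The algebra FQSym with colors\<close>

definition word_mult ::
  "(('a, 'c) cword \<Rightarrow> 'k::field) \<Rightarrow> (('a, 'c) cword \<Rightarrow> 'k) \<Rightarrow> ('a, 'c) cword \<Rightarrow> 'k" where
  "word_mult f g w = (\<Sum>(x, y) | x @ y = w. f x * g y)"

definition word_one :: "('a, 'c) cword \<Rightarrow> 'k::field" where
  "word_one w = (if w = [] then 1 else 0)"

definition GG ::
  "'a::linorder set \<Rightarrow> 'c set \<Rightarrow> (nat, 'c) cword \<Rightarrow> ('a, 'c) cword \<Rightarrow> 'k::field" where
  "GG B C p = (\<lambda>w. if w \<in> lists (B \<times> C) \<and> cstd w = p then 1 else 0)"

definition Letters :: "nat set" where
  "Letters = {1..}"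

definition FQSym_hom :: "'c set \<Rightarrow> nat \<Rightarrow> ((nat, 'c) cword \<Rightarrow> 'k::field) set" where
  "FQSym_hom C n = fun_vs.span (GG Letters C ` colored_perms_of_size C n)"

definition FQSym :: "'c set \<Rightarrow> ((nat, 'c) cword \<Rightarrow> 'k::field) set" where
  "FQSym C = fun_vs.span (GG Letters C ` colored_perms C)"

text \<open>
  The element @f(B)@ for an alphabet @B@ and @f@ in @FQSym C@: the image of @f@ under the linear
  map sending each @G_p(Letters)@ to @G_p(B)@ (the elements @G_p(Letters)@ are linearly
  independent, because they are sums over disjoint non-empty sets of words).
\<close>

definition at_alphabet ::
  "'b::linorder set \<Rightarrow> 'c set \<Rightarrow> ((nat, 'c) cword \<Rightarrow> 'k::field) \<Rightarrow> ('b, 'c) cword \<Rightarrow> 'k" where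
  "at_alphabet B C f =
     (THE g. \<forall>P a. finite P \<and> P \<subseteq> colored_perms C \<and>
          f = (\<Sum>p\<in>P. fscale (a p) (GG Letters C p)) \<longrightarrow>
        g = (\<Sum>p\<in>P. fscale (a p) (GG B C p)))"

text \<open>
  The ordered sum of two copies of @Letters@: the letter @a@ of the first copy is @(False, a)@ and the
  letter @a@ of the second one is @(True, a)@, in the lexicographic order with @False < True@.
\<close>

definition Letters2 :: "(bool \<times> nat) set" where
  "Letters2 = UNIV \<times> Letters"

definition copy :: "bool \<Rightarrow> (nat, 'c) cword \<Rightarrow> (bool \<times> nat, 'c) cword" where
  "copy b w = map (\<lambda>(a, c). ((b, a), c)) w"

inductive swap_step :: "(bool \<times> nat, 'c) cword \<Rightarrow> (bool \<times> nat, 'c) cword \<Rightarrow> bool" where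
  swap_step: "b \<noteq> b' \<Longrightarrow>
    swap_step (x @ [((b, a), c), ((b', a'), c')] @ y) (x @ [((b', a'), c'), ((b, a), c)] @ y)"

text \<open>
  Modulo the commutation of the two copies, every word is equivalent to exactly one word
  @copy False w' @ copy True w''@.  Hence a formal sum of words modulo commutation is a function of
  the pair @(w', w'')@, its value being the sum of the coefficients over the equivalence class.
  In this description the product of @f@ in the first copy and @g@ in the second one is @tens f g@.
\<close>

definition commuting_class ::
  "(nat, 'c) cword \<times> (nat, 'c) cword \<Rightarrow> (bool \<times> nat, 'c) cword set" where
  "commuting_class = (\<lambda>(w', w''). {w. swap_step\<^sup>*\<^sup>* (copy False w' @ copy True w'') w})"

definition coproduct ::
  "'c set \<Rightarrow> ((nat, 'c) cword \<Rightarrow> 'k::field) \<Rightarrow> (nat, 'c) cword \<times> (nat, 'c) cword \<Rightarrow> 'k" where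
  "coproduct C f = (\<lambda>ww. \<Sum>w\<in>commuting_class ww. at_alphabet Letters2 C f w)"

end

theory Submission
  imports Defs
begin

text \<open>
  Elements of FQSym are the formal sums of bounded degree whose coefficient at @w@ depends only on
  the standardization of @w@, so @f(B)@ has the coefficient @f (cstd w)@ at @w@ for every alphabet @B@.
  The commuting class of @(x,y)@ is the set of shuffles of the two copies of @x@ and @y@, and the
  inversions of such a shuffle are those of @x@, those of @y@, and others that depend only on
  the places taken by @x@ and @y@.  Hence the coefficient of the coproduct of @f@ at @(x,y)@ is the
  sum of @f@ over the shifted shuffle of the two standardizations.  A given @p@ lies in the
  shifted shuffle of exactly the pairs @(lo k p, hi k p)@ obtained by separating the values at most @k@ from
  the others, which gives the coproduct on the basis; coassociativity is the interchange of two such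
  cuts.  Multiplicativity holds because cutting a shuffle in two cuts both shuffled words.  Finally a
  left convolution inverse of the identity is defined by recursion on the size, and it is shown
  to be a right inverse as well.
\<close>

section \<open>Standardization and shuffles\<close>

text \<open>Words over different ordered alphabets must be compared throughout: words over
  \<open>Letters\<close>, words over the two copies, and permutations. The comparison is made
  through inversions, since two words have the same standardization exactly when they have the same
  colors and inversions. A colored permutation is itself a word over \<open>Letters\<close> that
  standardizes to itself, so \<open>f p\<close> is the coordinate of \<open>f\<close> at
  \<open>GG Letters C p\<close>. Expansions, evaluation at another alphabet and linear extension
  from the basis all rest on this one evaluation. Finiteness of \<open>C\<close> enters where
  bounded degree has to yield a finite combination of basis elements. The tensor operations are
  described over all representations by pure tensors, which is awkward to compute with. Product and
  counit avoid representations: there the operation is the restriction of a map that is linear on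
  all functions of pairs of words. Coassociativity and the antipode identities are linear in
  \<open>f\<close> and are checked on the basis, where the coproduct is a sum over the cuts at
  \<open>k = 0, ..., length p\<close>.\<close>

text \<open>Each of the values from 1 to \<open>\<sigma> ! i\<close> is taken exactly once. A
  permutation can thus be recovered from the comparisons between its entries.\<close>

lemma nth_permutation_eq_card:
  assumes "\<sigma> \<in> permutations_of_set {1..n}" "i < n"
  shows "\<sigma> ! i = card {j. j < n \<and> \<sigma> ! j \<le> \<sigma> ! i}"
proof -
  have len: "length \<sigma> = n" and \<sigma>: "set \<sigma> = {1..n}" "distinct \<sigma>"
    using assms(1) length_finite_permutations_of_set[of \<sigma> "{1..n}"] permutations_of_setD by auto
  have "(!) \<sigma> ` {j. j < n \<and> \<sigma> ! j \<le> \<sigma> ! i} = {1..\<sigma> ! i}"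
  proof -
    have "\<sigma> ! i \<le> n" using \<sigma> len assms(2) nth_mem[of i \<sigma>] by auto
    moreover have "m \<in> (!) \<sigma> ` {j. j < n \<and> \<sigma> ! j \<le> \<sigma> ! i}" if "1 \<le> m" "m \<le> \<sigma> ! i" "m \<le> n" for m
    proof -
      have "m \<in> set \<sigma>" using that \<sigma> by simp
      then obtain j where "j < n" "\<sigma> ! j = m" using len by (auto simp: in_set_conv_nth)
      then show ?thesis using that by blast
    qed
    moreover have "1 \<le> \<sigma> ! j" if "j < n" for j
      using \<sigma> len that nth_mem[of j \<sigma>] by auto
    ultimately show ?thesis by fastforce
  qed
  moreover have "inj_on ((!) \<sigma>) {j. j < n \<and> \<sigma> ! j \<le> \<sigma> ! i}"
    using \<sigma> len by (auto simp: inj_on_def nth_eq_iff_index_eq)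
  ultimately show ?thesis by (metis card_image card_atLeastAtMost diff_Suc_1)
qed

text \<open>The entries are distinct, so a pair that is not an inversion is strictly increasing. The
  inversions therefore decide all comparisons, hence all ranks. This is the uniqueness behind the
  description that defines \<open>std\<close>.\<close>

lemma permutation_eqI:
  assumes "\<sigma> \<in> permutations_of_set {1..n}" "\<tau> \<in> permutations_of_set {1..n}"
    and inv: "\<forall>j<n. \<forall>i<j. \<sigma> ! i > \<sigma> ! j \<longleftrightarrow> \<tau> ! i > \<tau> ! j"
  shows "\<sigma> = \<tau>"
proof (rule nth_equalityI)
  have len: "length \<sigma> = n" "length \<tau> = n"
    using assms(1,2) length_finite_permutations_of_set by fastforce+
  then show "length \<sigma> = length \<tau>" by simp
  fix i assume i: "i < length \<sigma>"
  have dist: "distinct \<sigma>" "distinct \<tau>" using assms permutations_of_setD by auto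
  have "\<sigma> ! j \<le> \<sigma> ! i \<longleftrightarrow> \<tau> ! j \<le> \<tau> ! i" if "j < n" for j
  proof (cases i j rule: linorder_cases)
    case less
    then have "\<sigma> ! i > \<sigma> ! j \<longleftrightarrow> \<tau> ! i > \<tau> ! j" using inv that by blast
    moreover have "\<sigma> ! i \<noteq> \<sigma> ! j" "\<tau> ! i \<noteq> \<tau> ! j"
      using less dist len that i by (auto simp: nth_eq_iff_index_eq)
    ultimately show ?thesis by linarith
  next
    case greater
    then have "\<sigma> ! j > \<sigma> ! i \<longleftrightarrow> \<tau> ! j > \<tau> ! i" using inv i len by blast
    then show ?thesis by linarith
  qed auto
  then have "{j. j < n \<and> \<sigma> ! j \<le> \<sigma> ! i} = {j. j < n \<and> \<tau> ! j \<le> \<tau> ! i}" by blast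
  then show "\<sigma> ! i = \<tau> ! i"
    using nth_permutation_eq_card[OF assms(1)] nth_permutation_eq_card[OF assms(2)] i len by metis
qed

lemma std_exists:
  fixes v :: "'a::linorder list"
  shows "\<exists>\<sigma>. \<sigma> \<in> permutations_of_set {1..length v} \<and>
     (\<forall>j<length v. \<forall>i<j. \<sigma> ! i > \<sigma> ! j \<longleftrightarrow> v ! i > v ! j)"
proof -
  let ?n = "length v"
  \<comment> \<open>Equal letters are ranked from left to right, so that a repeated letter creates
    no inversion.\<close>
  define below where "below i = {j. j < ?n \<and> (v ! j < v ! i \<or> v ! j = v ! i \<and> j \<le> i)}" for i
  define rk where "rk i = card (below i)" for i
  have fin: "finite (below i)" for i by (simp add: below_def)
  have mono: "rk i < rk j" if "j < ?n" "v ! i < v ! j \<or> v ! i = v ! j \<and> i < j" for i j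
  proof -
    have "below i \<subset> below j"
    proof
      show "below i \<subseteq> below j" using that by (auto simp: below_def)
      have "j \<in> below j" "j \<notin> below i" using that by (auto simp: below_def)
      then show "below i \<noteq> below j" by blast
    qed
    then show ?thesis unfolding rk_def by (intro psubset_card_mono fin)
  qed
  have inj: "inj_on rk {..<?n}"
  proof (rule inj_onI)
    fix i j assume "i \<in> {..<?n}" "j \<in> {..<?n}" "rk i = rk j"
    then show "i = j"
      using mono[of i j] mono[of j i] by (metis lessThan_iff less_irrefl linorder_less_linear)
  qed
  have "rk i \<in> {1..?n}" if "i < ?n" for i
  proof -
    have "i \<in> below i" using that by (simp add: below_def)
    then have "0 < rk i" unfolding rk_def using fin card_gt_0_iff by blast
    moreover have "rk i \<le> card {..<?n}"
      unfolding rk_def by (rule card_mono) (auto simp: below_def)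
    ultimately show ?thesis by simp
  qed
  then have "rk ` {..<?n} = {1..?n}"
    using inj by (intro card_subset_eq) (auto simp: card_image)
  then have "map rk [0..<?n] \<in> permutations_of_set {1..?n}"
    using inj by (intro permutations_of_setI) (auto simp: distinct_map atLeast0LessThan)
  moreover have "rk i > rk j \<longleftrightarrow> v ! i > v ! j" if "j < ?n" "i < j" for i j
    using mono[of i j] mono[of j i] that by (metis less_trans not_less_iff_gr_or_eq)
  ultimately show ?thesis by (intro exI[of _ "map rk [0..<?n]"]) simp
qed

lemma
  fixes v :: "'a::linorder list"
  shows std_permutation: "std v \<in> permutations_of_set {1..length v}"
    and std_inversions: "j < length v \<Longrightarrow> i < j \<Longrightarrow> std v ! i > std v ! j \<longleftrightarrow> v ! i > v ! j"
proof -
  have "\<exists>!\<sigma>. \<sigma> \<in> permutations_of_set {1..length v} \<and>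
     (\<forall>j<length v. \<forall>i<j. \<sigma> ! i > \<sigma> ! j \<longleftrightarrow> v ! i > v ! j)"
    using std_exists[of v] by (auto intro: permutation_eqI)
  from theI'[OF this, folded std_def]
  show "std v \<in> permutations_of_set {1..length v}"
    and "j < length v \<Longrightarrow> i < j \<Longrightarrow> std v ! i > std v ! j \<longleftrightarrow> v ! i > v ! j" by auto
qed

lemma length_std [simp]: "length (std v) = length v"
  using std_permutation length_finite_permutations_of_set by fastforce

lemma length_cstd [simp]: "length (cstd w) = length w"
  by (simp add: cstd_def)

lemma map_fst_cstd [simp]: "map fst (cstd w) = std (map fst w)"
  by (simp add: cstd_def)

lemma map_snd_cstd [simp]: "map snd (cstd w) = map snd w"
  by (simp add: cstd_def)

lemma cstd_eq_Nil_iff [simp]: "cstd w = [] \<longleftrightarrow> w = []"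
  by (metis length_0_conv length_cstd)

lemma cstd_Nil [simp]: "cstd [] = []"
  by simp

section \<open>Words with the same inversions\<close>

text \<open>The two alphabets may differ, so that a word over the copies can be compared with a
  permutation.\<close>

definition same_inv :: "('a::linorder, 'c) cword \<Rightarrow> ('b::linorder, 'c) cword \<Rightarrow> bool" where
  "same_inv w w' \<longleftrightarrow> map snd w = map snd w' \<and>
     (\<forall>j<length w. \<forall>i<j. fst (w ! i) > fst (w ! j) \<longleftrightarrow> fst (w' ! i) > fst (w' ! j))"

lemma same_inv_length: "same_inv w w' \<Longrightarrow> length w = length w'"
  unfolding same_inv_def using map_eq_imp_length_eq by blast

lemma same_inv_cstd: "same_inv (cstd w) w"
proof -
  have "fst (cstd w ! i) = std (map fst w) ! i" if "i < length w" for i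
    using that by (simp add: cstd_def)
  then show ?thesis
    using std_inversions[of _ "map fst w"] by (auto simp: same_inv_def)
qed

lemma same_inv_sym: "same_inv w w' \<Longrightarrow> same_inv w' w"
  using same_inv_length[of w w'] by (auto simp: same_inv_def)

lemma same_inv_trans: "same_inv w w' \<Longrightarrow> same_inv w' w'' \<Longrightarrow> same_inv w w''"
  using same_inv_length[of w w'] by (auto simp: same_inv_def)

text \<open>Each word has the inversions of its standardization, and a permutation is determined by
  its inversions. All later facts about \<open>cstd\<close> of factors and images of words are
  reduced to inversions here.\<close>

lemma cstd_eq_iff: "cstd w = cstd w' \<longleftrightarrow> same_inv w w'"
proof
  show "same_inv w w'" if "cstd w = cstd w'"
    using same_inv_cstd[of w] same_inv_cstd[of w'] that by (metis same_inv_sym same_inv_trans)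
next
  assume s: "same_inv w w'"
  then have len: "length w' = length w" using same_inv_length by metis
  have "std (map fst w) = std (map fst w')"
  proof (rule permutation_eqI)
    show "std (map fst w) \<in> permutations_of_set {1..length w}"
      using std_permutation[of "map fst w"] by simp
    show "std (map fst w') \<in> permutations_of_set {1..length w}"
      using std_permutation[of "map fst w'"] len by simp
    show "\<forall>j<length w. \<forall>i<j. std (map fst w) ! i > std (map fst w) ! j \<longleftrightarrow>
        std (map fst w') ! i > std (map fst w') ! j"
      using std_inversions[of _ "map fst w"] std_inversions[of _ "map fst w'"] s len
      by (auto simp: same_inv_def)
  qed
  then show "cstd w = cstd w'" using s by (simp add: cstd_def same_inv_def)
qed

lemma cstd_cstd [simp]: "cstd (cstd w) = cstd w"
  by (simp add: cstd_eq_iff same_inv_cstd)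

text \<open>The inversions of a factor are the inversions of the whole word between positions in
  that factor.\<close>

lemma cstd_take: "cstd w = cstd w' \<Longrightarrow> cstd (take n w) = cstd (take n w')"
  using same_inv_length[of w w'] by (auto simp: cstd_eq_iff same_inv_def simp flip: take_map)

lemma cstd_drop: "cstd w = cstd w' \<Longrightarrow> cstd (drop n w) = cstd (drop n w')"
  using same_inv_length[of w w']
  by (auto simp: cstd_eq_iff same_inv_def less_diff_conv add.commute simp flip: drop_map)

lemma cstd_map:
  assumes "\<And>x. x \<in> set w \<Longrightarrow> snd (\<phi> x) = snd x"
    and "\<And>x y. x \<in> set w \<Longrightarrow> y \<in> set w \<Longrightarrow> fst (\<phi> x) < fst (\<phi> y) \<longleftrightarrow> fst x < fst y"
  shows "cstd (map \<phi> w) = cstd w"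
  using assms by (auto simp: cstd_eq_iff same_inv_def)

lemma cstd_copy [simp]: "cstd (copy b w) = cstd w"
  unfolding copy_def by (rule cstd_map) (auto simp: less_prod_def')

lemma cstd_shift [simp]: "cstd (shift k w) = cstd w"
  unfolding shift_def by (rule cstd_map) auto

section \<open>Colored permutations\<close>

lemma colored_perms_of_size_iff:
  "p \<in> colored_perms_of_size C n \<longleftrightarrow>
     length p = n \<and> set (map fst p) = {1..n} \<and> distinct (map fst p) \<and> snd ` set p \<subseteq> C"
proof -
  have "map fst p \<in> permutations_of_set {1..n} \<Longrightarrow> length p = n"
    using length_finite_permutations_of_set[of "map fst p" "{1..n}"] by simp
  then show ?thesis
    unfolding colored_perms_of_size_def permutations_of_set_def by auto
qed

lemma colored_perms_iff: "p \<in> colored_perms C \<longleftrightarrow> p \<in> colored_perms_of_size C (length p)"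
  unfolding colored_perms_def by (auto simp: colored_perms_of_size_iff)

lemma cstd_colored_perm:
  assumes "p \<in> colored_perms C"
  shows "cstd p = p"
proof -
  have "map fst p \<in> permutations_of_set {1..length p}"
    using assms unfolding colored_perms_iff colored_perms_of_size_def by blast
  then have "std (map fst p) = map fst p"
    using std_permutation[of "map fst p"] std_inversions[of _ "map fst p"]
    by (intro permutation_eqI[of _ "length p"]) auto
  then show ?thesis by (simp add: cstd_def zip_map_fst_snd)
qed

lemma cstd_in_colored_perms:
  assumes "snd ` set w \<subseteq> C"
  shows "cstd w \<in> colored_perms C"
proof -
  have "set (map snd (cstd w)) \<subseteq> C" using assms by (simp only: map_snd_cstd set_map)
  then show ?thesis
    using std_permutation[of "map fst w"]
    unfolding colored_perms_iff colored_perms_of_size_def length_cstd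
      mem_Collect_eq map_fst_cstd length_map by blast
qed

lemma colored_perms_in_lists: "p \<in> colored_perms C \<Longrightarrow> p \<in> lists (Letters \<times> C)"
  by (force simp: colored_perms_iff colored_perms_of_size_iff Letters_def)

lemma cstd_in_lists: "w \<in> lists (B \<times> C) \<Longrightarrow> cstd w \<in> colored_perms C"
  by (rule cstd_in_colored_perms) fastforce

lemma finite_colored_perms_of_size:
  assumes "finite C"
  shows "finite (colored_perms_of_size C n)"
proof (rule finite_subset)
  show "colored_perms_of_size C n \<subseteq> {p. set p \<subseteq> {1..n} \<times> C \<and> length p = n}"
    by (force simp: colored_perms_of_size_iff)
  show "finite {p. set p \<subseteq> {1..n} \<times> C \<and> length p = n}"
    using assms by (intro finite_lists_length_eq) auto
qed

section \<open>Shuffles\<close>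

lemma map_shuffles: "map h ` shuffles xs ys = shuffles (map h xs) (map h ys)"
proof (induction xs ys rule: shuffles.induct)
  case (3 x xs y ys)
  have "map h ` (#) z ` A = (#) (h z) ` map h ` A" for z A
    by (simp add: image_image)
  then show ?case using 3 by (simp add: image_Un)
qed auto

text \<open>The image of a letter reveals from which of the two words it comes, and the order inside
  each word is fixed. Hence \<open>h\<close> may identify letters of the same word.\<close>

lemma inj_on_map_shuffles:
  assumes "h ` set xs \<inter> h ` set ys = {}"
  shows "inj_on (map h) (shuffles xs ys)"
  using assms
proof (induction xs ys rule: shuffles.induct)
  case (3 x xs y ys)
  then have "inj_on (map h) (shuffles xs (y # ys))" "inj_on (map h) (shuffles (x # xs) ys)"
    by auto
  moreover have "h x \<noteq> h y" using "3.prems" by auto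
  ultimately show ?case by (fastforce simp: inj_on_def)
qed auto

text \<open>\<open>R\<close> is not meant as an order: \<open>sorted_wrt\<close> expresses a
  condition on all pairs of positions. Letters of different factors may appear in either order in a
  shuffle, which is why both \<open>R x y\<close> and \<open>R y x\<close> are required.\<close>

lemma sorted_wrt_shuffles:
  assumes "zs \<in> shuffles xs ys" "sorted_wrt R xs" "sorted_wrt R ys"
    and "\<And>x y. x \<in> set xs \<Longrightarrow> y \<in> set ys \<Longrightarrow> R x y \<and> R y x"
  shows "sorted_wrt R zs"
  using assms
proof (induction xs ys arbitrary: zs rule: shuffles.induct)
  case (3 x xs y ys)
  from "3.prems"(1) consider zs' where "zs = x # zs'" "zs' \<in> shuffles xs (y # ys)"
    | zs' where "zs = y # zs'" "zs' \<in> shuffles (x # xs) ys" by auto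
  then show ?case
  proof cases
    case 1
    then have "sorted_wrt R zs'" using "3.IH"(1)[of zs'] "3.prems" by auto
    then show ?thesis using 1 "3.prems" set_shuffles[OF 1(2)] by auto
  next
    case 2
    then have "sorted_wrt R zs'" using "3.IH"(2)[of zs'] "3.prems" by auto
    then show ?thesis using 2 "3.prems" set_shuffles[OF 2(2)] by auto
  qed
qed auto

text \<open>A predicate that separates the letters of the two words undoes the shuffle. The two
  filter equations are easy to follow under cuts and commutations.\<close>

lemma shuffles_iff_filter:
  assumes "\<forall>x\<in>set xs. P x" "\<forall>y\<in>set ys. \<not> P y"
  shows "zs \<in> shuffles xs ys \<longleftrightarrow> filter P zs = xs \<and> filter (\<lambda>z. \<not> P z) zs = ys"
proof
  assume zs: "zs \<in> shuffles xs ys"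
  have "filter P zs \<in> shuffles (filter P xs) (filter P ys)"
    "filter (\<lambda>z. \<not> P z) zs \<in> shuffles (filter (\<lambda>z. \<not> P z) xs) (filter (\<lambda>z. \<not> P z) ys)"
    unfolding filter_shuffles[symmetric] using zs by blast+
  moreover have "filter P xs = xs" "filter P ys = []"
    "filter (\<lambda>z. \<not> P z) xs = []" "filter (\<lambda>z. \<not> P z) ys = ys"
    using assms by (auto simp: filter_id_conv filter_empty_conv)
  ultimately show "filter P zs = xs \<and> filter (\<lambda>z. \<not> P z) zs = ys" by simp
qed (use partition_in_shuffles in blast)

text \<open>
  Zipping @x@ with @x'@ and @y@ with @y'@ carries the shuffles of one pair to those of the other;
  the inversions between letters of different factors are forced by the order of the factors.
\<close>

lemma sum_shuffles_cstd_cong: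
  fixes x y :: "('a::linorder, 'c) cword" and x' y' :: "('b::linorder, 'c) cword"
  assumes x: "cstd x = cstd x'" and y: "cstd y = cstd y'"
    and less: "\<And>a b. a \<in> set x \<Longrightarrow> b \<in> set y \<Longrightarrow> fst a < fst b"
    and less': "\<And>a b. a \<in> set x' \<Longrightarrow> b \<in> set y' \<Longrightarrow> fst a < fst b"
  shows "(\<Sum>w\<in>shuffles x y. f (cstd w)) = (\<Sum>w\<in>shuffles x' y'. f (cstd w))"
proof -
  \<comment> \<open>On a zipped word, \<open>R\<close> says for a pair of positions that it is an
    inversion of both projections or of neither.\<close>
  define R :: "(('a \<times> 'c) \<times> ('b \<times> 'c)) \<Rightarrow> (('a \<times> 'c) \<times> ('b \<times> 'c)) \<Rightarrow> bool" where
    "R s t \<longleftrightarrow> snd (fst s) = snd (snd s) \<and> snd (fst t) = snd (snd t) \<and>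
      (fst (fst s) > fst (fst t) \<longleftrightarrow> fst (snd s) > fst (snd t))" for s t
  let ?X = "zip x x'" and ?Y = "zip y y'"
  have len: "length x = length x'" "length y = length y'" using x y by (metis length_cstd)+
  \<comment> \<open>For a word of one letter \<open>sorted_wrt\<close> is void, so the equality of
    colors is recorded separately.\<close>
  have inv: "sorted_wrt R (zip w w')" "\<forall>s\<in>set (zip w w'). snd (fst s) = snd (snd s)"
    if "cstd w = cstd w'" for w w'
  proof -
    have s: "same_inv w w'" using that cstd_eq_iff by blast
    then have 1: "length w = length w'" by (rule same_inv_length)
    have 2: "snd (w ! i) = snd (w' ! i)" if "i < length w" for i
      using s 1 that unfolding same_inv_def by (metis nth_map)
    show "\<forall>s\<in>set (zip w w'). snd (fst s) = snd (snd s)"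
    proof
      fix s assume "s \<in> set (zip w w')"
      then obtain i where "i < length w" "s = (w ! i, w' ! i)" by (auto simp: set_zip)
      then show "snd (fst s) = snd (snd s)" using 2 by simp
    qed
    show "sorted_wrt R (zip w w')"
      unfolding sorted_wrt_iff_nth_less R_def
      using s 1 2 by (auto simp: same_inv_def)
  qed
  have cross: "R s t \<and> R t s" if "s \<in> set ?X" "t \<in> set ?Y" for s t
  proof -
    have "fst s \<in> set x" "fst t \<in> set y" "snd s \<in> set x'" "snd t \<in> set y'"
      using that by (metis prod.collapse set_zip_leftD set_zip_rightD)+
    then have "fst (fst s) < fst (fst t)" "fst (snd s) < fst (snd t)"
      using less less' by blast+
    then show ?thesis using that inv(2)[OF x] inv(2)[OF y] unfolding R_def by auto
  qed
  have eq: "cstd (map fst W) = cstd (map snd W)" if W: "W \<in> shuffles ?X ?Y" for W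
  proof -
    have "sorted_wrt R W" using sorted_wrt_shuffles[OF W inv(1)[OF x] inv(1)[OF y] cross] .
    moreover have "\<forall>s\<in>set W. snd (fst s) = snd (snd s)"
      using set_shuffles[OF W] inv(2)[OF x] inv(2)[OF y] by auto
    ultimately show ?thesis
      unfolding cstd_eq_iff same_inv_def sorted_wrt_iff_nth_less R_def by auto
  qed
  \<comment> \<open>The first factor lies below the second, so no letter is common to both and the
    projection of the zipped shuffles is injective.\<close>
  have "fst ` set ?X \<inter> fst ` set ?Y = {}"
    using less by (fastforce dest: set_zip_leftD)
  then have 1: "(\<Sum>w\<in>shuffles x y. f (cstd w)) = (\<Sum>W\<in>shuffles ?X ?Y. f (cstd (map fst W)))"
    using len map_shuffles[of fst ?X ?Y] sum.reindex[OF inj_on_map_shuffles, of fst ?X ?Y]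
    by simp
  have "snd ` set ?X \<inter> snd ` set ?Y = {}"
    using less' by (fastforce dest: set_zip_rightD)
  then have 2: "(\<Sum>w\<in>shuffles x' y'. f (cstd w)) = (\<Sum>W\<in>shuffles ?X ?Y. f (cstd (map snd W)))"
    using len map_shuffles[of snd ?X ?Y] sum.reindex[OF inj_on_map_shuffles, of snd ?X ?Y]
    by simp
  show ?thesis unfolding 1 2 by (intro sum.cong refl) (simp add: eq)
qed

section \<open>Commutation classes of words over two copies\<close>

definition first_copy :: "(bool \<times> nat) \<times> 'c \<Rightarrow> bool" where
  "first_copy s \<longleftrightarrow> \<not> fst (fst s)"

lemma filter_copy [simp]:
  "filter first_copy (copy b x) = (if b then [] else copy b x)"
  "filter (\<lambda>s. \<not> first_copy s) (copy b x) = (if b then copy b x else [])"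
  by (auto simp: copy_def first_copy_def filter_empty_conv filter_id_conv)

lemma shuffles_copies_iff:
  "w \<in> shuffles (copy False x) (copy True y) \<longleftrightarrow>
     filter first_copy w = copy False x \<and> filter (\<lambda>s. \<not> first_copy s) w = copy True y"
  by (rule shuffles_iff_filter) (auto simp: copy_def first_copy_def)

lemma swap_step_Cons: "swap_step w w' \<Longrightarrow> swap_step (s # w) (s # w')"
proof (erule swap_step.cases)
  fix b b' :: bool and x a c a' c' y
  assume "w = x @ [((b, a), c), ((b', a'), c')] @ y" "w' = x @ [((b', a'), c'), ((b, a), c)] @ y"
    and "b \<noteq> b'"
  then show "swap_step (s # w) (s # w')"
    using swap_step.intros[of b b' "s # x" a c a' c' y] by simp
qed

lemma swap_steps_Cons: "swap_step\<^sup>*\<^sup>* w w' \<Longrightarrow> swap_step\<^sup>*\<^sup>* (s # w) (s # w')"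
  by (induction rule: rtranclp_induct) (auto intro: rtranclp.rtrancl_into_rtrancl swap_step_Cons)

text \<open>The letter of the second copy passes the letters of the first copy one at a time, each
  by a single swap.\<close>

lemma swap_steps_move_left:
  "swap_step\<^sup>*\<^sup>* (copy False x @ [((True, b), d)] @ z) (((True, b), d) # copy False x @ z)"
proof (induction x)
  case (Cons s x)
  obtain a c where s: "s = (a, c)" by fastforce
  have "swap_step\<^sup>*\<^sup>* (copy False (s # x) @ [((True, b), d)] @ z)
      (((False, a), c) # ((True, b), d) # copy False x @ z)"
    using swap_steps_Cons[OF Cons] by (simp add: copy_def s)
  moreover have "swap_step (((False, a), c) # ((True, b), d) # copy False x @ z)
      (((True, b), d) # ((False, a), c) # copy False x @ z)"
    using swap_step.intros[of False True "[]" a c b d "copy False x @ z"] by simp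
  ultimately show ?case by (simp add: copy_def s)
qed (simp add: copy_def)

text \<open>The shuffle is built from its first letter on: a letter from \<open>y\<close> is moved
  to the front past the whole copy of \<open>x\<close>, a letter from \<open>x\<close> is already
  there, and the rest is rearranged by induction.\<close>

lemma swap_steps_of_shuffle:
  assumes "w \<in> shuffles (copy False x) (copy True y)"
  shows "swap_step\<^sup>*\<^sup>* (copy False x @ copy True y) w"
  using assms
proof (induction w arbitrary: x y)
  case (Cons s w)
  from Cons.prems consider
      a c x' where "x = (a, c) # x'" "s = ((False, a), c)" "w \<in> shuffles (copy False x') (copy True y)"
    | b d y' where "y = (b, d) # y'" "s = ((True, b), d)" "w \<in> shuffles (copy False x) (copy True y')"
    unfolding Cons_in_shuffles_iff copy_def by (cases x; cases y) auto
  then show ?case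
  proof cases
    case 1
    then show ?thesis using swap_steps_Cons[OF Cons.IH[OF 1(3)]] by (simp add: copy_def)
  next
    case 2
    have "swap_step\<^sup>*\<^sup>* (copy False x @ copy True y) (s # copy False x @ copy True y')"
      using swap_steps_move_left[of x b d "copy True y'"] 2 by (simp add: copy_def)
    then show ?thesis using swap_steps_Cons[OF Cons.IH[OF 2(3)], of s] by simp
  qed
qed (auto simp: copy_def)

text \<open>A swap exchanges letters of different copies only, so the subword in each copy is
  invariant; this confines the class to the shuffles, and every shuffle is reached.\<close>

lemma commuting_class_eq:
  "commuting_class (x, y) = shuffles (copy False x) (copy True y)"
proof -
  have "filter first_copy w = copy False x \<and> filter (\<lambda>s. \<not> first_copy s) w = copy True y"
    if "swap_step\<^sup>*\<^sup>* (copy False x @ copy True y) w" for w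
    using that
  proof (induction rule: rtranclp_induct)
    case (step w w')
    from step(2) have "filter first_copy w = filter first_copy w'"
      "filter (\<lambda>s. \<not> first_copy s) w = filter (\<lambda>s. \<not> first_copy s) w'"
    proof (atomize (full), cases)
      case (swap_step b b' x a c a' c' y)
      then show "filter first_copy w = filter first_copy w' \<and>
          filter (\<lambda>s. \<not> first_copy s) w = filter (\<lambda>s. \<not> first_copy s) w'"
        by (cases b; cases b') (simp_all add: first_copy_def)
    qed
    then show ?case using step by simp
  qed simp
  then have "swap_step\<^sup>*\<^sup>* (copy False x @ copy True y) w \<longleftrightarrow> w \<in> shuffles (copy False x) (copy True y)" for w
    using swap_steps_of_shuffle shuffles_copies_iff by blast
  then show ?thesis unfolding commuting_class_def by blast
qed

section \<open>Tensor products and the product of words\<close>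

lemma sum_fun_apply: "(\<Sum>a\<in>A. F a) z = (\<Sum>a\<in>A. F a z)"
  for F :: "'b \<Rightarrow> 'z \<Rightarrow> 'w::comm_monoid_add"
  by (induction A rule: infinite_finite_induct) auto

lemma fscale_apply [simp]: "fscale c f x = c * f x"
  by (simp add: fscale_def)

text \<open>Two nested cuts at \<open>j \<le> k\<close> can be summed from either side, with
  \<open>i = k - j\<close> the size of the middle block. Associativity, coassociativity and the
  right antipode identity all use this exchange.\<close>

lemma sum_atMost_triangle:
  fixes a :: "nat \<Rightarrow> nat \<Rightarrow> 'b::comm_monoid_add"
  shows "(\<Sum>k\<le>n. \<Sum>j\<le>k. a j (k - j)) = (\<Sum>j\<le>n. \<Sum>i\<le>n - j. a j i)"
proof -
  have "(\<Sum>k\<le>n. \<Sum>j\<le>k. a j (k - j)) = (\<Sum>(j, i)\<in>{(j, i). j + i \<le> n}. a j i)"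
    by (rule sum.triangle_reindex_eq[symmetric])
  also have "{(j, i). j + i \<le> n} = (SIGMA j:{..n}. {..n - j})"
    by auto
  finally show ?thesis by (simp add: sum.Sigma)
qed

lemma tens_apply [simp]: "tens f g (x, y) = f x * g y"
  by (simp add: tens_def)

lemma linear_on_comp:
  assumes "linear_on V fscale \<phi>" "\<And>f. f \<in> V \<Longrightarrow> \<phi> f \<in> W" "linear_on W s \<psi>"
  shows "linear_on V s (\<lambda>f. \<psi> (\<phi> f))"
  using assms by (simp add: linear_on_def)

lemma bilinear_on_comp:
  assumes "bilinear_on UNIV UNIV fscale \<gamma>" "linear_on V fscale \<phi>" "linear_on W fscale \<psi>"
  shows "bilinear_on V W fscale (\<lambda>f g. \<gamma> (\<phi> f) (\<psi> g))"
  using assms by (simp add: bilinear_on_def linear_on_def)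

lemma linear_on_id: "linear_on V fscale (\<lambda>f. f)" "linear_on V fscale id"
  by (simp_all add: linear_on_def)

lemma fscale_sum: "fscale c (sum F A) = (\<Sum>a\<in>A. fscale c (F a))"
  by (auto simp: fun_eq_iff sum_fun_apply sum_distrib_left)

lemma tens_in_tensor_space: "f \<in> V \<Longrightarrow> g \<in> W \<Longrightarrow> tens f g \<in> tensor_space V W"
  unfolding tensor_space_def by (blast intro: fun_vs.span_base)

lemma subspace_tensor_space: "fun_vs.subspace (tensor_space V W)"
  unfolding tensor_space_def by (rule fun_vs.subspace_span)

lemma fscale_tsum: "fscale c (tsum ps) = tsum (map (\<lambda>(f, g). (fscale c f, g)) ps)"
  by (induction ps) (auto simp: tsum_def fun_eq_iff algebra_simps)

lemma tensor_space_tsum: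
  assumes "F \<in> tensor_space V W" "fun_vs.subspace V"
  obtains ps where "ps \<in> lists (V \<times> W)" "F = tsum ps"
proof -
  have "\<exists>ps\<in>lists (V \<times> W). F = tsum ps"
    using assms(1) unfolding tensor_space_def
  proof (induction rule: fun_vs.span_induct_alt)
    case base
    show ?case by (rule bexI[of _ "[]"]) (auto simp: tsum_def)
  next
    case (step c x y)
    then obtain f g ps where "x = tens f g" "f \<in> V" "g \<in> W" "ps \<in> lists (V \<times> W)" "y = tsum ps"
      by blast
    moreover have "fscale c (tens f g) + tsum ps = tsum ((fscale c f, g) # ps)"
      by (auto simp: tsum_def fun_eq_iff algebra_simps)
    ultimately show ?case
      using assms(2) by (intro bexI[of _ "(fscale c f, g) # ps"]) (auto simp: fun_vs.subspace_scale)
  qed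
  then show thesis using that by blast
qed

text \<open>Concatenating representations represents the sum, and scaling the first factors
  represents the scalar multiple; by \<open>tlift_tsum\<close> the value does not depend on the
  representation.\<close>

lemma linear_on_tlift:
  fixes \<beta> :: "('x \<Rightarrow> 'k::field) \<Rightarrow> ('y \<Rightarrow> 'k) \<Rightarrow> 'z \<Rightarrow> 'k"
  assumes \<beta>: "bilinear_on V W fscale \<beta>" and V: "fun_vs.subspace V" and W: "fun_vs.subspace W"
  shows "linear_on (tensor_space V W) fscale (tlift V W \<beta>)"
  unfolding linear_on_def
proof (intro conjI ballI allI)
  fix F G assume "F \<in> tensor_space V W" "G \<in> tensor_space V W"
  then obtain ps qs where p: "ps \<in> lists (V \<times> W)" "F = tsum ps" and q: "qs \<in> lists (V \<times> W)" "G = tsum qs"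
    using V tensor_space_tsum by metis
  have "F + G = tsum (ps @ qs)" by (simp add: p q tsum_def)
  then show "tlift V W \<beta> (F + G) = tlift V W \<beta> F + tlift V W \<beta> G"
    using p q tlift_tsum[OF \<beta> V W, of "ps @ qs"] tlift_tsum[OF \<beta> V W, of ps]
      tlift_tsum[OF \<beta> V W, of qs] by simp
next
  fix c F assume "F \<in> tensor_space V W"
  then obtain ps where p: "ps \<in> lists (V \<times> W)" "F = tsum ps"
    using V tensor_space_tsum by metis
  let ?qs = "map (\<lambda>(f, g). (fscale c f, g)) ps"
  have q: "?qs \<in> lists (V \<times> W)" using p V by (fastforce simp: fun_vs.subspace_scale)
  have "(\<Sum>(f, g)\<leftarrow>?qs. \<beta> f g) = fscale c (\<Sum>(f, g)\<leftarrow>ps. \<beta> f g)"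
    using p(1)
  proof (induction ps rule: list.induct)
    case (Cons s ps)
    then obtain f g where s: "s = (f, g)" "f \<in> V" "g \<in> W" by auto
    then have "\<beta> (fscale c f) g = fscale c (\<beta> f g)"
      using \<beta> unfolding bilinear_on_def linear_on_def by blast
    moreover have "ps \<in> lists (V \<times> W)" using Cons.prems by simp
    ultimately show ?case
      unfolding s list.map prod.case sum_list.Cons fun_vs.scale_right_distrib
      by (simp only: Cons.IH)
  qed (simp add: fun_eq_iff)
  then show "tlift V W \<beta> (fscale c F) = fscale c (tlift V W \<beta> F)"
    using tlift_tsum[OF \<beta> V W p(1)] tlift_tsum[OF \<beta> V W q] p(2) by (simp add: fscale_tsum)
qed

lemma tlift_sum_tens:
  assumes \<beta>: "bilinear_on V W s \<beta>" and V: "fun_vs.subspace V" and W: "fun_vs.subspace W"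
    and K: "finite K" "\<And>k. k \<in> K \<Longrightarrow> a k \<in> V" "\<And>k. k \<in> K \<Longrightarrow> b k \<in> W"
  shows "tlift V W \<beta> (\<Sum>k\<in>K. tens (a k) (b k)) = (\<Sum>k\<in>K. \<beta> (a k) (b k))"
proof -
  obtain ks where ks: "set ks = K" "distinct ks" using K(1) finite_distinct_list by metis
  let ?ps = "map (\<lambda>k. (a k, b k)) ks"
  have eq: "(\<Sum>(f, g)\<leftarrow>?ps. \<gamma> f g) = (\<Sum>k\<in>K. \<gamma> (a k) (b k))" for \<gamma> :: "_ \<Rightarrow> _ \<Rightarrow> 'w::comm_monoid_add"
    using sum.distinct_set_conv_list[OF ks(2), of "\<lambda>k. \<gamma> (a k) (b k)"] ks(1)
    by (simp add: comp_def)
  have "?ps \<in> lists (V \<times> W)" using K ks by auto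
  from tlift_tsum[OF \<beta> V W this] show ?thesis unfolding tsum_def eq .
qed

text \<open>For a bilinear map that factors through a linear map on all functions of pairs, the lift
  is that linear map. Product and counit on tensors are computed this way without choosing a
  representation.\<close>

lemma tlift_linear:
  assumes \<Phi>: "linear_on UNIV fscale \<Phi>" and V: "fun_vs.subspace V" and W: "fun_vs.subspace W"
    and F: "F \<in> tensor_space V W"
  shows "tlift V W (\<lambda>f g. \<Phi> (tens f g)) F = \<Phi> F"
proof -
  have \<beta>: "bilinear_on V W fscale (\<lambda>f g. \<Phi> (tens f g))"
    using bilinear_on_tens[of V W] \<Phi> by (simp add: bilinear_on_def linear_on_def)
  obtain ps where ps: "ps \<in> lists (V \<times> W)" "F = tsum ps"
    using tensor_space_tsum[OF F V] .
  have "(\<Sum>(f, g)\<leftarrow>ps. \<Phi> (tens f g)) = \<Phi> (tsum ps)"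
    using \<Phi> linear_on_zero[OF \<Phi>] by (induction ps) (auto simp: tsum_def linear_on_def)
  then show ?thesis using tlift_tsum[OF \<beta> V W ps(1)] ps(2) by simp
qed

section \<open>The concatenation product\<close>

lemma word_splits: "{(x, y). x @ y = w} = (\<lambda>i. (take i w, drop i w)) ` {..length w}"
proof -
  have "(x, y) = (take (length x) (x @ y), drop (length x) (x @ y))" for x y :: "'a list"
    by simp
  then show ?thesis by (fastforce simp: image_iff)
qed

lemma word_mult_eq: "word_mult f g w = (\<Sum>i\<le>length w. f (take i w) * g (drop i w))"
proof -
  have "inj_on (\<lambda>i. (take i w, drop i w)) {..length w}"
    by (rule inj_on_inverseI[where g = "\<lambda>(x, y). length x"]) auto
  then show ?thesis unfolding word_mult_def word_splits by (simp add: sum.reindex)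
qed

lemma bilinear_on_word_mult: "bilinear_on V W fscale word_mult"
  by (auto simp: bilinear_on_def linear_on_def word_mult_eq fun_eq_iff algebra_simps
      sum.distrib sum_distrib_left)

lemma word_mult_assoc: "word_mult (word_mult f g) h = word_mult f (word_mult g h)"
proof
  fix w
  \<comment> \<open>Here \<open>j\<close> and \<open>i\<close> are the lengths of the first and
    second of the three factors of \<open>w\<close>.\<close>
  let ?a = "\<lambda>j i. f (take j w) * g (take i (drop j w)) * h (drop (i + j) w)"
  have "word_mult (word_mult f g) h w = (\<Sum>i\<le>length w. \<Sum>j\<le>i. ?a j (i - j))"
    by (simp add: word_mult_eq sum_distrib_right drop_take min_absorb1 min_absorb2
        cong: sum.cong_simp)
  also have "\<dots> = (\<Sum>j\<le>length w. \<Sum>i\<le>length w - j. ?a j i)"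
    by (rule sum_atMost_triangle)
  also have "\<dots> = word_mult f (word_mult g h) w"
    by (simp add: word_mult_eq sum_distrib_left mult.assoc)
  finally show "word_mult (word_mult f g) h w = word_mult f (word_mult g h) w" .
qed

lemma word_mult_one [simp]: "word_mult word_one f = f" "word_mult f word_one = f"
proof -
  show "word_mult word_one f = f"
  proof
    fix w
    have "word_mult word_one f w = (\<Sum>i\<le>length w. if i = 0 then f w else 0)"
      unfolding word_mult_eq by (intro sum.cong) (auto simp: word_one_def)
    then show "word_mult word_one f w = f w" by simp
  qed
  show "word_mult f word_one = f"
  proof
    fix w
    have "word_mult f word_one w = (\<Sum>i\<le>length w. if i = length w then f w else 0)"
      unfolding word_mult_eq by (intro sum.cong) (auto simp: word_one_def)
    then show "word_mult f word_one w = f w" by simp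
  qed
qed

lemma word_mult_sum_left: "word_mult (\<Sum>a\<in>A. F a) g = (\<Sum>a\<in>A. word_mult (F a) g)"
  by (auto simp: fun_eq_iff word_mult_eq sum_fun_apply sum_distrib_right intro: sum.swap)

lemma word_mult_sum_right: "word_mult f (\<Sum>a\<in>A. G a) = (\<Sum>a\<in>A. word_mult f (G a))"
  by (auto simp: fun_eq_iff word_mult_eq sum_fun_apply sum_distrib_left intro: sum.swap)

section \<open>The basis of FQSym\<close>

text \<open>A colored permutation is a word over \<open>Letters\<close> and its own standardization.
  Evaluation at \<open>q\<close> therefore reads off the coordinate at
  \<open>GG Letters C q\<close>.\<close>

lemma GG_colored_perm: "q \<in> colored_perms C \<Longrightarrow> GG Letters C p q = (if q = p then 1 else 0)"
  using colored_perms_in_lists[of q C] by (simp add: GG_def cstd_colored_perm)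

lemma GG_cstd: "w \<in> lists (B \<times> C) \<Longrightarrow> GG B C p w = GG Letters C p (cstd w)"
  using colored_perms_in_lists[OF cstd_in_lists[of w B C]] by (simp add: GG_def)

lemma GG_nonzero: "GG B C p w \<noteq> 0 \<Longrightarrow> w \<in> lists (B \<times> C) \<and> cstd w = p"
  by (simp add: GG_def split: if_splits)

lemma GG_Nil [simp]: "GG B C [] = word_one"
  by (auto simp: GG_def word_one_def fun_eq_iff)

lemma subspace_FQSym: "fun_vs.subspace (FQSym C)"
  unfolding FQSym_def by (rule fun_vs.subspace_span)

lemma GG_in_FQSym: "p \<in> colored_perms C \<Longrightarrow> GG Letters C p \<in> FQSym C"
  unfolding FQSym_def by (blast intro: fun_vs.span_base)

lemma FQSym_eq_cstd:
  assumes "f \<in> FQSym C"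
  shows "f w = (if w \<in> lists (Letters \<times> C) then f (cstd w) else 0)"
proof (cases "w \<in> lists (Letters \<times> C)")
  case True
  have "f w = f (cstd w)"
    using assms unfolding FQSym_def
    by (induction rule: fun_vs.span_induct_alt) (auto simp: GG_cstd[OF True])
  then show ?thesis using True by simp
next
  case False
  have G: "GG Letters C p w = 0" for p using False unfolding GG_def by argo
  have "f w = 0"
    using assms unfolding FQSym_def
    by (induction rule: fun_vs.span_induct_alt) (auto simp: G)
  then show ?thesis using False by simp
qed

lemma finite_FQSym_support:
  assumes "f \<in> FQSym C"
  shows "finite {p \<in> colored_perms C. f p \<noteq> 0}"
  using assms unfolding FQSym_def
proof (induction rule: fun_vs.span_induct_alt)
  case (step c x y)
  then obtain q where q: "x = GG Letters C q" by blast
  have "{p \<in> colored_perms C. (fscale c x + y) p \<noteq> 0} \<subseteq> insert q {p \<in> colored_perms C. y p \<noteq> 0}"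
    by (auto simp: q GG_colored_perm split: if_splits)
  then show ?case using step finite_subset by blast
qed simp

lemma FQSym_expansion:
  assumes f: "f \<in> FQSym C" and P: "finite P" "P \<subseteq> colored_perms C"
    and supp: "{p \<in> colored_perms C. f p \<noteq> 0} \<subseteq> P"
  shows "f = (\<Sum>p\<in>P. fscale (f p) (GG Letters C p))"
proof
  fix w
  show "f w = (\<Sum>p\<in>P. fscale (f p) (GG Letters C p)) w"
  proof (cases "w \<in> lists (Letters \<times> C)")
    case True
    have "(\<Sum>p\<in>P. f p * GG Letters C p w) = (\<Sum>p\<in>P. if p = cstd w then f (cstd w) else 0)"
      using True by (intro sum.cong) (auto simp: GG_def)
    also have "\<dots> = f (cstd w)"
      using P(1) supp cstd_in_lists[OF True] by auto
    finally show ?thesis using FQSym_eq_cstd[OF f, of w] True by (simp add: sum_fun_apply)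
  next
    case False
    then show ?thesis using FQSym_eq_cstd[OF f, of w] by (simp add: sum_fun_apply GG_def)
  qed
qed

text \<open>Since \<open>C\<close> is finite, there are finitely many colored permutations of
  bounded size, so bounded degree makes the expansion with coefficients \<open>f p\<close> finite.
  Membership can then be checked on coefficients.\<close>

lemma FQSym_iff:
  assumes "finite C"
  shows "f \<in> FQSym C \<longleftrightarrow> (\<exists>N. \<forall>w. f w \<noteq> 0 \<longrightarrow> length w \<le> N) \<and>
    (\<forall>w. f w = (if w \<in> lists (Letters \<times> C) then f (cstd w) else 0))"
proof
  assume f: "f \<in> FQSym C"
  let ?P = "{p \<in> colored_perms C. f p \<noteq> 0}"
  have "length w \<le> Max (insert 0 (length ` ?P))" if "f w \<noteq> 0" for w
  proof -
    have "cstd w \<in> ?P"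
      using FQSym_eq_cstd[OF f, of w] that cstd_in_lists[of w Letters C] by (auto split: if_splits)
    then have "length (cstd w) \<in> length ` ?P" by (rule imageI)
    then show ?thesis using finite_FQSym_support[OF f] by (intro Max_ge) auto
  qed
  then show "(\<exists>N. \<forall>w. f w \<noteq> 0 \<longrightarrow> length w \<le> N) \<and>
    (\<forall>w. f w = (if w \<in> lists (Letters \<times> C) then f (cstd w) else 0))"
    using FQSym_eq_cstd[OF f] by blast
next
  assume "(\<exists>N. \<forall>w. f w \<noteq> 0 \<longrightarrow> length w \<le> N) \<and>
    (\<forall>w. f w = (if w \<in> lists (Letters \<times> C) then f (cstd w) else 0))"
  then obtain N where N: "\<And>w. f w \<noteq> 0 \<Longrightarrow> length w \<le> N"
    and f: "\<And>w. f w = (if w \<in> lists (Letters \<times> C) then f (cstd w) else 0)" by blast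
  define P where "P = (\<Union>n\<le>N. colored_perms_of_size C n)"
  have P: "finite P" "P \<subseteq> colored_perms C"
    using finite_colored_perms_of_size[OF assms] by (auto simp: P_def colored_perms_def)
  have "f w = (\<Sum>p\<in>P. fscale (f p) (GG Letters C p)) w" for w
  proof (cases "w \<in> lists (Letters \<times> C)")
    case True
    have "f (cstd w) = 0" if "cstd w \<notin> P"
    proof (rule ccontr)
      assume "f (cstd w) \<noteq> 0"
      then have "length (cstd w) \<le> N" by (rule N)
      then show False using that cstd_in_lists[OF True] by (auto simp: P_def colored_perms_iff)
    qed
    moreover have "(\<Sum>p\<in>P. f p * GG Letters C p w) = (\<Sum>p\<in>P. if p = cstd w then f (cstd w) else 0)"
      using True by (intro sum.cong) (auto simp: GG_def)
    ultimately show ?thesis using f[of w] True P(1) by (auto simp: sum_fun_apply)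
  next
    case False
    then show ?thesis using f[of w] by (simp add: sum_fun_apply GG_def)
  qed
  then have "f = (\<Sum>p\<in>P. fscale (f p) (GG Letters C p))" by blast
  also have "\<dots> \<in> FQSym C"
    using P(2) by (intro fun_vs.subspace_sum fun_vs.subspace_scale subspace_FQSym GG_in_FQSym) blast
  finally show "f \<in> FQSym C" .
qed

lemma FQSym_hom_iff:
  "f \<in> FQSym_hom C n \<longleftrightarrow> f \<in> FQSym C \<and> (\<forall>w. f w \<noteq> 0 \<longrightarrow> length w = n)"
proof
  assume f: "f \<in> FQSym_hom C n"
  have "f w = 0" if "length w \<noteq> n" for w
    using f unfolding FQSym_hom_def
  proof (induction rule: fun_vs.span_induct_alt)
    case (step c x y)
    then obtain p where "x = GG Letters C p" "length p = n"
      by (auto simp: colored_perms_of_size_iff)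
    then have "x w = 0" using that GG_nonzero[of Letters C p w] length_cstd[of w] by metis
    then show ?case using step by simp
  qed simp
  moreover have "f \<in> FQSym C"
    using f fun_vs.span_mono[of "GG Letters C ` colored_perms_of_size C n" "GG Letters C ` colored_perms C"]
    unfolding FQSym_hom_def FQSym_def colored_perms_def by blast
  ultimately show "f \<in> FQSym C \<and> (\<forall>w. f w \<noteq> 0 \<longrightarrow> length w = n)" by blast
next
  assume f: "f \<in> FQSym C \<and> (\<forall>w. f w \<noteq> 0 \<longrightarrow> length w = n)"
  let ?P = "{p \<in> colored_perms C. f p \<noteq> 0}"
  have "f = (\<Sum>p\<in>?P. fscale (f p) (GG Letters C p))"
    using f by (intro FQSym_expansion finite_FQSym_support) auto
  also have "\<dots> \<in> FQSym_hom C n"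
    unfolding FQSym_hom_def
    using f by (intro fun_vs.span_sum fun_vs.span_scale fun_vs.span_base imageI)
      (auto simp: colored_perms_iff)
  finally show "f \<in> FQSym_hom C n" .
qed

lemma word_one_in_FQSym: "word_one \<in> FQSym C"
  using GG_in_FQSym[of "[]" C] by (simp add: colored_perms_iff colored_perms_of_size_iff)

text \<open>A factor of a permutation is in general no permutation, but \<open>f\<close> sees only
  its standardization, which agrees with that of the corresponding factor of
  \<open>w\<close>.\<close>

lemma FQSym_take_cstd:
  assumes "f \<in> FQSym C" "w \<in> lists (B \<times> C)"
  shows "f (take i (cstd w)) = f (cstd (take i w))" "f (drop i (cstd w)) = f (cstd (drop i w))"
proof -
  have "cstd w \<in> lists (Letters \<times> C)"
    using assms(2) cstd_in_lists colored_perms_in_lists by blast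
  then have "take i (cstd w) \<in> lists (Letters \<times> C)" "drop i (cstd w) \<in> lists (Letters \<times> C)"
    by (auto dest: in_set_takeD in_set_dropD)
  then show "f (take i (cstd w)) = f (cstd (take i w))" "f (drop i (cstd w)) = f (cstd (drop i w))"
    using FQSym_eq_cstd[OF assms(1)] cstd_take[of "cstd w" w i] cstd_drop[of "cstd w" w i] by simp_all
qed

lemma word_mult_cstd:
  assumes "f \<in> FQSym C" "g \<in> FQSym C" "w \<in> lists (B \<times> C)"
  shows "word_mult f g (cstd w) = (\<Sum>i\<le>length w. f (cstd (take i w)) * g (cstd (drop i w)))"
  by (simp add: word_mult_eq FQSym_take_cstd[OF assms(1,3)] FQSym_take_cstd[OF assms(2,3)])

text \<open>The coefficient at \<open>w\<close> involves only the standardizations of prefixes and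
  suffixes of \<open>w\<close>, which are determined by \<open>cstd w\<close>; the degree bounds add
  up.\<close>

lemma word_mult_in_FQSym:
  assumes "finite C" and f: "f \<in> FQSym C" and g: "g \<in> FQSym C"
  shows "word_mult f g \<in> FQSym C"
  unfolding FQSym_iff[OF assms(1)]
proof (intro conjI allI)
  obtain M N where M: "\<And>w. f w \<noteq> 0 \<Longrightarrow> length w \<le> M" and N: "\<And>w. g w \<noteq> 0 \<Longrightarrow> length w \<le> N"
    using f g unfolding FQSym_iff[OF assms(1)] by blast
  have "length w \<le> M + N" if nz: "word_mult f g w \<noteq> 0" for w
  proof -
    obtain i where "i \<in> {..length w}" "f (take i w) * g (drop i w) \<noteq> 0"
      using sum.not_neutral_contains_not_neutral[OF nz[unfolded word_mult_eq]] .
    then have i: "i \<le> length w" "f (take i w) \<noteq> 0" "g (drop i w) \<noteq> 0" by auto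
    then show ?thesis using M[OF i(2)] N[OF i(3)] by simp
  qed
  then show "\<exists>N. \<forall>w. word_mult f g w \<noteq> 0 \<longrightarrow> length w \<le> N" by blast
next
  fix w
  show "word_mult f g w = (if w \<in> lists (Letters \<times> C) then word_mult f g (cstd w) else 0)"
  proof (cases "w \<in> lists (Letters \<times> C)")
    case True
    have t: "take i w \<in> lists (Letters \<times> C)" "drop i w \<in> lists (Letters \<times> C)" for i
      using True by (auto dest: in_set_takeD in_set_dropD)
    have "f (take i w) = f (cstd (take i w))" "g (drop i w) = g (cstd (drop i w))" for i
      using FQSym_eq_cstd[OF f, of "take i w"] FQSym_eq_cstd[OF g, of "drop i w"] t by simp_all
    then have "word_mult f g w = word_mult f g (cstd w)"
      unfolding word_mult_cstd[OF f g True] unfolding word_mult_eq by presburger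
    then show ?thesis using True by argo
  next
    case False
    have "f (take i w) * g (drop i w) = 0" for i
    proof -
      have "\<not> (take i w \<in> lists (Letters \<times> C) \<and> drop i w \<in> lists (Letters \<times> C))"
        using False by (metis append_in_lists_conv append_take_drop_id)
      then show ?thesis using FQSym_eq_cstd[OF f, of "take i w"] FQSym_eq_cstd[OF g, of "drop i w"]
        by (metis mult_eq_0_iff)
    qed
    then have "word_mult f g w = 0" unfolding word_mult_eq by (intro sum.neutral) blast
    then show ?thesis using False by argo
  qed
qed

text \<open>At a word \<open>w\<close> over \<open>B\<close>, each \<open>GG B C p\<close> takes the
  value of \<open>GG Letters C p\<close> at \<open>cstd w\<close>. Every expansion of
  \<open>f\<close> thus gives the same result, and one expansion exists.\<close>

lemma at_alphabet_eq:
  fixes f :: "(nat, 'c) cword \<Rightarrow> 'k::field" and B :: "'b::linorder set"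
  assumes f: "f \<in> FQSym C"
  shows "at_alphabet B C f = (\<lambda>w. if w \<in> lists (B \<times> C) then f (cstd w) else 0)"
  unfolding at_alphabet_def
proof (rule the_equality)
  let ?g = "\<lambda>w :: ('b, 'c) cword. if w \<in> lists (B \<times> C) then f (cstd w) else 0"
  show all: "\<forall>P a. finite P \<and> P \<subseteq> colored_perms C \<and> f = (\<Sum>p\<in>P. fscale (a p) (GG Letters C p)) \<longrightarrow>
      ?g = (\<Sum>p\<in>P. fscale (a p) (GG B C p))"
  proof (intro allI impI ext)
    fix P a and w :: "('b, 'c) cword"
    assume "finite P \<and> P \<subseteq> colored_perms C \<and> f = (\<Sum>p\<in>P. fscale (a p) (GG Letters C p))"
    then have "f (cstd w) = (\<Sum>p\<in>P. a p * GG Letters C p (cstd w))" by (simp add: sum_fun_apply)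
    then show "?g w = (\<Sum>p\<in>P. fscale (a p) (GG B C p)) w"
    proof (cases "w \<in> lists (B \<times> C)")
      case False
      have "GG B C p w = (0 :: 'k)" for p using False unfolding GG_def by argo
      then show ?thesis using False by (simp add: sum_fun_apply)
    qed (simp add: sum_fun_apply GG_cstd[of w B C])
  qed
  let ?P = "{p \<in> colored_perms C. f p \<noteq> 0}"
  \<comment> \<open>A single expansion suffices to force the value of \<open>g\<close>.\<close>
  have P: "finite ?P \<and> ?P \<subseteq> colored_perms C \<and> f = (\<Sum>p\<in>?P. fscale (f p) (GG Letters C p))"
    using FQSym_expansion[OF f finite_FQSym_support[OF f]] finite_FQSym_support[OF f] by blast
  fix g
  assume "\<forall>P a. finite P \<and> P \<subseteq> colored_perms C \<and> f = (\<Sum>p\<in>P. fscale (a p) (GG Letters C p)) \<longrightarrow>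
      g = (\<Sum>p\<in>P. fscale (a p) (GG B C p))"
  then have "g = (\<Sum>p\<in>?P. fscale (f p) (GG B C p))" using P by blast
  also have "\<dots> = ?g" by (rule all[THEN spec, THEN spec, THEN mp, OF P, symmetric])
  finally show "g = ?g" .
qed

lemma linear_on_FQSym_eqI:
  assumes "linear_on (FQSym C) s \<phi>" "linear_on (FQSym C) s \<psi>"
    and "\<And>p. p \<in> colored_perms C \<Longrightarrow> \<phi> (GG Letters C p) = \<psi> (GG Letters C p)"
    and f: "f \<in> FQSym C"
  shows "\<phi> f = \<psi> f"
proof -
  have "f \<in> FQSym C \<and> \<phi> f = \<psi> f"
    using f unfolding FQSym_def
  proof (induction rule: fun_vs.span_induct_alt)
    case base
    show ?case
      using linear_on_zero[OF assms(1) subspace_FQSym] linear_on_zero[OF assms(2) subspace_FQSym]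
        fun_vs.subspace_0[OF subspace_FQSym] unfolding FQSym_def by metis
  next
    case (step c x y)
    then obtain p where p: "p \<in> colored_perms C" "x = GG Letters C p" by blast
    have x: "x \<in> FQSym C" "\<phi> x = \<psi> x" using p GG_in_FQSym assms(3) by auto
    have y: "y \<in> FQSym C" "\<phi> y = \<psi> y" using step unfolding FQSym_def by blast+
    have cx: "fscale c x \<in> FQSym C" using x subspace_FQSym fun_vs.subspace_scale by blast
    have "fscale c x + y \<in> FQSym C" using cx y(1) subspace_FQSym fun_vs.subspace_add by blast
    moreover have eq: "\<chi> (fscale c x + y) = s c (\<chi> x) + \<chi> y" if \<chi>: "linear_on (FQSym C) s \<chi>" for \<chi>
    proof -
      have "\<chi> (fscale c x + y) = \<chi> (fscale c x) + \<chi> y"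
        using \<chi> y(1) cx unfolding linear_on_def by blast
      also have "\<chi> (fscale c x) = s c (\<chi> x)" using \<chi> x(1) unfolding linear_on_def by blast
      finally show ?thesis .
    qed
    ultimately show ?case
      unfolding eq[OF assms(1)] eq[OF assms(2)] x(2) y(2) FQSym_def by blast
  qed
  then show ?thesis by blast
qed

text \<open>The linear map on \<open>FQSym C\<close> with prescribed values \<open>S p\<close> on
  the basis, \<open>f p\<close> being the coordinate of \<open>f\<close>. It will produce the
  antipode.\<close>

definition basis_extension ::
  "'c set \<Rightarrow> ((nat, 'c) cword \<Rightarrow> 'z \<Rightarrow> 'k::field) \<Rightarrow> ((nat, 'c) cword \<Rightarrow> 'k) \<Rightarrow> 'z \<Rightarrow> 'k" where
  "basis_extension C S f = (\<Sum>p | p \<in> colored_perms C \<and> f p \<noteq> 0. fscale (f p) (S p))"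

lemma basis_extension_superset:
  assumes "finite P" "P \<subseteq> colored_perms C" "{p \<in> colored_perms C. f p \<noteq> 0} \<subseteq> P"
  shows "basis_extension C S f = (\<Sum>p\<in>P. fscale (f p) (S p))"
  unfolding basis_extension_def
proof (rule sum.mono_neutral_left)
  show "\<forall>p\<in>P - {p. p \<in> colored_perms C \<and> f p \<noteq> 0}. fscale (f p) (S p) = 0"
    using assms(2) by (auto simp: fun_eq_iff)
qed (use assms in auto)

lemma linear_on_basis_extension: "linear_on (FQSym C) fscale (basis_extension C S)"
  unfolding linear_on_def
proof (intro conjI ballI allI)
  fix f g :: "(nat, 'a) cword \<Rightarrow> 'b" assume f: "f \<in> FQSym C" and g: "g \<in> FQSym C"
  \<comment> \<open>A common index set is needed because cancellation can make the support of
    \<open>f + g\<close> smaller.\<close>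
  let ?P = "{p \<in> colored_perms C. f p \<noteq> 0} \<union> {p \<in> colored_perms C. g p \<noteq> 0}"
  have "finite ?P" using finite_FQSym_support f g by blast
  then have "basis_extension C S h = (\<Sum>p\<in>?P. fscale (h p) (S p))"
    if "\<And>p. f p = 0 \<Longrightarrow> g p = 0 \<Longrightarrow> h p = 0" for h
    by (rule basis_extension_superset) (use that in auto)
  from this[of f] this[of g] this[of "f + g"]
  show "basis_extension C S (f + g) = basis_extension C S f + basis_extension C S g"
    by (simp add: sum.distrib fun_vs.scale_left_distrib del: fscale_apply flip: sum.distrib)
next
  fix c and f :: "(nat, 'a) cword \<Rightarrow> 'b" assume f: "f \<in> FQSym C"
  have "basis_extension C S (fscale c f) = (\<Sum>p | p \<in> colored_perms C \<and> f p \<noteq> 0. fscale (fscale c f p) (S p))"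
    by (rule basis_extension_superset) (use finite_FQSym_support[OF f] in auto)
  also have "\<dots> = fscale c (basis_extension C S f)"
    unfolding basis_extension_def fscale_sum by simp
  finally show "basis_extension C S (fscale c f) = fscale c (basis_extension C S f)" .
qed

lemma basis_extension_GG:
  assumes "p \<in> colored_perms C"
  shows "basis_extension C S (GG Letters C p) = S p"
proof -
  have "basis_extension C S (GG Letters C p) = (\<Sum>q\<in>{p}. fscale (GG Letters C p q) (S q))"
    by (rule basis_extension_superset) (use assms in \<open>auto simp: GG_colored_perm split: if_splits\<close>)
  then show ?thesis using assms by (simp add: GG_colored_perm fun_eq_iff)
qed

section \<open>The coproduct\<close>

lemma at_alphabet_FQSym_add_scale:
  assumes f: "f \<in> FQSym C"
  shows "g \<in> FQSym C \<Longrightarrow> at_alphabet B C (f + g) = at_alphabet B C f + at_alphabet B C g"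
    and "at_alphabet B C (fscale c f) = fscale c (at_alphabet B C f)"
proof -
  show "at_alphabet B C (f + g) = at_alphabet B C f + at_alphabet B C g" if g: "g \<in> FQSym C"
    using at_alphabet_eq[OF f, of B] at_alphabet_eq[OF g, of B]
      at_alphabet_eq[OF fun_vs.subspace_add[OF subspace_FQSym f g], of B]
    by (auto simp: fun_eq_iff)
  show "at_alphabet B C (fscale c f) = fscale c (at_alphabet B C f)"
    using at_alphabet_eq[OF f, of B]
      at_alphabet_eq[OF fun_vs.subspace_scale[OF subspace_FQSym f, of c], of B]
    by (auto simp: fun_eq_iff)
qed

lemma linear_on_coproduct: "linear_on (FQSym C) fscale (coproduct C)"
  unfolding linear_on_def coproduct_def
  by (auto simp: at_alphabet_FQSym_add_scale fun_eq_iff sum.distrib sum_distrib_left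
      simp del: fscale_apply plus_fun_apply)
    (auto simp: sum.distrib sum_distrib_left)

lemma set_copy: "set (copy b w) = (\<lambda>(a, c). ((b, a), c)) ` set w"
  by (simp add: copy_def)

lemma copies_in_lists:
  assumes "w \<in> shuffles (copy False x) (copy True y)"
  shows "w \<in> lists (Letters2 \<times> C) \<longleftrightarrow> x \<in> lists (Letters \<times> C) \<and> y \<in> lists (Letters \<times> C)"
  using set_shuffles[OF assms] by (auto simp: set_copy Letters2_def lists_eq_set)

lemma coproduct_eq_copies:
  assumes f: "f \<in> FQSym C"
  shows "coproduct C f (x, y) =
    (if x \<in> lists (Letters \<times> C) \<and> y \<in> lists (Letters \<times> C)
     then \<Sum>w\<in>shuffles (copy False x) (copy True y). f (cstd w) else 0)"
proof -
  have "coproduct C f (x, y) = (\<Sum>w\<in>shuffles (copy False x) (copy True y).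
      if x \<in> lists (Letters \<times> C) \<and> y \<in> lists (Letters \<times> C) then f (cstd w) else 0)"
    unfolding coproduct_def at_alphabet_eq[OF f] commuting_class_eq
    by (intro sum.cong refl) (simp only: copies_in_lists)
  then show ?thesis by (cases "x \<in> lists (Letters \<times> C) \<and> y \<in> lists (Letters \<times> C)") auto
qed

lemma set_shift: "set (shift k w) = (\<lambda>(a, c). (a + k, c)) ` set w"
  by (simp add: shift_def)

lemma length_shift [simp]: "length (shift k w) = length w"
  by (simp add: shift_def)

lemma colored_perm_letter:
  assumes "p \<in> colored_perms C" "s \<in> set p"
  shows "fst s \<in> {1..length p}"
proof -
  have "fst ` set p = {1..length p}"
    using assms(1) unfolding colored_perms_iff colored_perms_of_size_iff set_map by blast
  then show ?thesis using assms(2) by blast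
qed

lemma shifted_shuffle_colored_perm:
  assumes p: "p \<in> colored_perms C" and q: "q \<in> colored_perms C" and r: "r \<in> shifted_shuffle p q"
  shows "r \<in> colored_perms C"
proof -
  let ?q = "shift (length p) q"
  have r': "r \<in> shuffles p ?q" using r by (simp add: shifted_shuffle_def)
  have p': "fst ` set p = {1..length p}" "distinct (map fst p)" "snd ` set p \<subseteq> C"
    and q': "fst ` set q = {1..length q}" "distinct (map fst q)" "snd ` set q \<subseteq> C"
    using p q by (simp_all add: colored_perms_iff colored_perms_of_size_iff)
  have fq: "map fst ?q = map (\<lambda>a. a + length p) (map fst q)"
    by (auto simp: shift_def)
  then have dq: "distinct (map fst ?q)" using q'(2) by (simp add: distinct_map inj_on_def)
  have "fst ` set ?q = (\<lambda>a. a + length p) ` fst ` set q" using fq by (metis set_map)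
  also have "\<dots> = {length p + 1..length p + length q}" unfolding q' by (simp add: add.commute)
  finally have sq: "fst ` set ?q = {length p + 1..length p + length q}" .
  have len: "length r = length p + length q" using length_shuffles[OF r'] by simp
  have "set r = set p \<union> set ?q" using set_shuffles[OF r'] .
  then have "fst ` set r = {1..length r}" "snd ` set r \<subseteq> C"
    unfolding len using p' q' sq by (auto simp: image_Un set_shift)
  moreover have "map fst r \<in> shuffles (map fst p) (map fst ?q)"
    using r' map_shuffles[of fst p ?q] by blast
  then have "distinct (map fst r)"
    by (rule distinct_disjoint_shuffles[OF p'(2) dq, rotated]) (simp add: p'(1) sq)
  ultimately show ?thesis by (simp add: colored_perms_iff colored_perms_of_size_iff)
qed

lemma coproduct_eq_shifted_shuffle:
  assumes f: "f \<in> FQSym C" and x: "x \<in> lists (Letters \<times> C)" and y: "y \<in> lists (Letters \<times> C)"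
  shows "coproduct C f (x, y) = (\<Sum>p\<in>shifted_shuffle (cstd x) (cstd y). f p)"
proof -
  have cx: "cstd x \<in> colored_perms C" and cy: "cstd y \<in> colored_perms C"
    using x y cstd_in_lists by blast+
  have "coproduct C f (x, y) = (\<Sum>w\<in>shuffles (copy False x) (copy True y). f (cstd w))"
    using coproduct_eq_copies[OF f] x y by simp
  \<comment> \<open>On one side the order of the copies, on the other the shift by the length, puts
    the first factor below the second.\<close>
  also have "\<dots> = (\<Sum>w\<in>shuffles (cstd x) (shift (length (cstd x)) (cstd y)). f (cstd w))"
  proof (rule sum_shuffles_cstd_cong)
    show "fst a < fst b" if "a \<in> set (copy False x)" "b \<in> set (copy True y)" for a b
      using that by (auto simp: set_copy less_prod_def')
    fix a b assume a: "a \<in> set (cstd x)" and b: "b \<in> set (shift (length (cstd x)) (cstd y))"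
    have "fst a \<le> length (cstd x)" using colored_perm_letter[OF cx a] by simp
    moreover obtain b' where "b' \<in> set (cstd y)" "fst b = fst b' + length (cstd x)"
      using b by (auto simp: set_shift)
    then have "fst b > length (cstd x)" using colored_perm_letter[OF cy] by fastforce
    ultimately show "fst a < fst b" by simp
  qed simp_all
  also have "\<dots> = (\<Sum>p\<in>shifted_shuffle (cstd x) (cstd y). f p)"
    unfolding shifted_shuffle_def[symmetric]
    by (intro sum.cong refl arg_cong[where f = f]
        cstd_colored_perm[OF shifted_shuffle_colored_perm[OF cx cy]])
  finally show ?thesis .
qed

section \<open>Cutting a permutation at a value\<close>

definition lo :: "nat \<Rightarrow> (nat, 'c) cword \<Rightarrow> (nat, 'c) cword" where
  "lo k p = filter (\<lambda>s. fst s \<le> k) p"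

definition hi :: "nat \<Rightarrow> (nat, 'c) cword \<Rightarrow> (nat, 'c) cword" where
  "hi k p = map (\<lambda>(a, c). (a - k, c)) (filter (\<lambda>s. \<not> fst s \<le> k) p)"

lemma shift_hi: "shift k (hi k p) = filter (\<lambda>s. \<not> fst s \<le> k) p"
  by (induction p) (auto simp: shift_def hi_def)

lemma hi_shift: "filter (\<lambda>s. \<not> fst s \<le> k) p = shift k q \<Longrightarrow> hi k p = q"
  unfolding hi_def by (auto simp: shift_def comp_def split_beta)

lemma
  assumes "p \<in> colored_perms_of_size C n" "k \<le> n"
  shows lo_colored_perm: "lo k p \<in> colored_perms_of_size C k"
    and hi_colored_perm: "hi k p \<in> colored_perms_of_size C (n - k)"
proof -
  have p: "fst ` set p = {1..n}" "distinct (map fst p)" "snd ` set p \<subseteq> C"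
    using assms(1) by (simp_all add: colored_perms_of_size_iff)
  have 1: "map fst (lo k p) = filter (\<lambda>a. a \<le> k) (map fst p)"
    by (simp add: lo_def filter_map comp_def)
  then have "distinct (map fst (lo k p))" using p by simp
  moreover have "set (map fst (lo k p)) = {1..k}"
    unfolding 1 set_filter set_map p using assms(2) by auto
  ultimately show "lo k p \<in> colored_perms_of_size C k"
    using p(3) distinct_card[of "map fst (lo k p)"] by (auto simp: colored_perms_of_size_iff lo_def)
  have 2: "map fst (hi k p) = map (\<lambda>a. a - k) (filter (\<lambda>a. \<not> a \<le> k) (map fst p))"
    by (simp add: hi_def filter_map comp_def split_beta)
  then have "distinct (map fst (hi k p))" using p by (auto simp: distinct_map inj_on_def)
  moreover have "set (map fst (hi k p)) = {1..n - k}"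
  proof -
    have "set (map fst (hi k p)) = (\<lambda>a. a - k) ` {k + 1..n}"
      unfolding 2 set_filter set_map p by (intro image_cong) auto
    also have "\<dots> = {1..n - k}"
      by (auto simp: image_iff intro!: bexI[of _ "_ + k"])
    finally show ?thesis .
  qed
  ultimately show "hi k p \<in> colored_perms_of_size C (n - k)"
    using p(3) distinct_card[of "map fst (hi k p)"] by (auto simp: colored_perms_of_size_iff hi_def)
qed

lemma lo_hi_perms:
  assumes "p \<in> colored_perms C" "k \<le> length p"
  shows "lo k p \<in> colored_perms C" "hi k p \<in> colored_perms C"
    "length (lo k p) = k" "length (hi k p) = length p - k"
  using lo_colored_perm[of p C "length p" k] hi_colored_perm[of p C "length p" k] assms
  by (auto simp: colored_perms_iff colored_perms_of_size_iff)

text \<open>The values of \<open>p'\<close> are at most its length and those of the shifted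
  \<open>p''\<close> exceed it, so comparison with \<open>length p'\<close> separates the two
  shuffled words.\<close>

lemma in_shifted_shuffle_iff:
  assumes "p' \<in> colored_perms C" "p'' \<in> colored_perms C"
  shows "p \<in> shifted_shuffle p' p'' \<longleftrightarrow> lo (length p') p = p' \<and> hi (length p') p = p''"
proof -
  let ?k = "length p'"
  have "\<forall>s\<in>set p'. fst s \<le> ?k" using colored_perm_letter[OF assms(1)] by simp
  moreover have "\<forall>s\<in>set (shift ?k p''). \<not> fst s \<le> ?k"
    using colored_perm_letter[OF assms(2)] by (fastforce simp: set_shift)
  ultimately have "p \<in> shifted_shuffle p' p'' \<longleftrightarrow>
      lo ?k p = p' \<and> filter (\<lambda>s. \<not> fst s \<le> ?k) p = shift ?k p''"
    unfolding shifted_shuffle_def lo_def by (rule shuffles_iff_filter)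
  then show ?thesis using shift_hi hi_shift by metis
qed

text \<open>Lengths add under shuffling, so the first factor has some size
  \<open>k \<le> length p\<close>, and \<open>k\<close> determines both factors. In particular the
  sum in the coproduct formula is finite.\<close>

lemma shuffle_factors:
  assumes "p \<in> colored_perms C"
  shows "{(p', p''). p' \<in> colored_perms C \<and> p'' \<in> colored_perms C \<and> p \<in> shifted_shuffle p' p''} =
    (\<lambda>k. (lo k p, hi k p)) ` {..length p}"
proof (intro equalityI subsetI)
  fix s assume "s \<in> {(p', p''). p' \<in> colored_perms C \<and> p'' \<in> colored_perms C \<and> p \<in> shifted_shuffle p' p''}"
  then obtain p' p'' where s: "s = (p', p'')" "p' \<in> colored_perms C" "p'' \<in> colored_perms C"
      "p \<in> shifted_shuffle p' p''" by blast
  then have "length p = length p' + length p''"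
    using length_shuffles unfolding shifted_shuffle_def by fastforce
  then show "s \<in> (\<lambda>k. (lo k p, hi k p)) ` {..length p}"
    using s in_shifted_shuffle_iff[OF s(2,3)] by (intro image_eqI[of _ _ "length p'"]) auto
next
  fix s assume "s \<in> (\<lambda>k. (lo k p, hi k p)) ` {..length p}"
  then show "s \<in> {(p', p''). p' \<in> colored_perms C \<and> p'' \<in> colored_perms C \<and> p \<in> shifted_shuffle p' p''}"
    using lo_hi_perms[OF assms] in_shifted_shuffle_iff by fastforce
qed

text \<open>At a pair \<open>(x, y)\<close> of colored words over \<open>Letters\<close>, the only
  tensor that can contribute is the one indexed by \<open>(cstd x, cstd y)\<close>. Both sides are
  therefore 1 or 0 according to whether \<open>p\<close> lies in the shifted shuffle of these
  standardizations.\<close>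

lemma coproduct_GG_shuffle:
  fixes C :: "'c set"
  assumes p: "p \<in> colored_perms C"
  shows "coproduct C (GG Letters C p :: (nat, 'c) cword \<Rightarrow> 'k::field) =
    (\<Sum>(p', p'') | p' \<in> colored_perms C \<and> p'' \<in> colored_perms C \<and> p \<in> shifted_shuffle p' p''.
       tens (GG Letters C p') (GG Letters C p''))"
proof
  let ?S = "{(p', p''). p' \<in> colored_perms C \<and> p'' \<in> colored_perms C \<and> p \<in> shifted_shuffle p' p''}"
  let ?G = "GG Letters C :: _ \<Rightarrow> (nat, 'c) cword \<Rightarrow> 'k"
  fix s :: "(nat, 'c) cword \<times> (nat, 'c) cword"
  obtain x y where s: "s = (x, y)" by fastforce
  have fin: "finite ?S" unfolding shuffle_factors[OF p] by blast
  show "coproduct C (?G p) s = (\<Sum>(p', p'')\<in>?S. tens (?G p') (?G p'')) s"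
  proof (cases "x \<in> lists (Letters \<times> C) \<and> y \<in> lists (Letters \<times> C)")
    case True
    then have c: "cstd x \<in> colored_perms C" "cstd y \<in> colored_perms C" using cstd_in_lists by blast+
    have "coproduct C (?G p) s = (\<Sum>q\<in>shifted_shuffle (cstd x) (cstd y). ?G p q)"
      unfolding s using True by (intro coproduct_eq_shifted_shuffle GG_in_FQSym p) auto
    also have "\<dots> = (\<Sum>q\<in>shifted_shuffle (cstd x) (cstd y). if q = p then 1 else 0)"
      using shifted_shuffle_colored_perm[OF c] by (intro sum.cong refl GG_colored_perm)
    also have "\<dots> = (if (cstd x, cstd y) \<in> ?S then 1 else 0)"
      using c by (simp add: shifted_shuffle_def)
    also have "\<dots> = (\<Sum>t\<in>?S. if t = (cstd x, cstd y) then 1 else 0)" using fin by simp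
    also have "\<dots> = (\<Sum>(p', p'')\<in>?S. tens (?G p') (?G p'') s)"
      using True by (intro sum.cong refl) (auto simp: s GG_def split: if_splits)
    finally show ?thesis by (simp add: sum_fun_apply split_beta)
  next
    case False
    have z: "tens (?G p') (?G p'') s = 0" for p' p''
      using False unfolding s tens_apply GG_def by auto
    have "(\<Sum>(p', p'')\<in>?S. tens (?G p') (?G p'')) s = 0"
      by (simp add: sum_fun_apply split_beta z)
    moreover have "coproduct C (?G p) s = 0"
      unfolding s coproduct_eq_copies[OF GG_in_FQSym[OF p]] using False by (rule if_not_P)
    ultimately show ?thesis by (simp only:)
  qed
qed

lemma coproduct_GG:
  fixes C :: "'c set"
  assumes p: "p \<in> colored_perms C"
  shows "coproduct C (GG Letters C p :: (nat, 'c) cword \<Rightarrow> 'k::field) =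
    (\<Sum>k\<le>length p. tens (GG Letters C (lo k p)) (GG Letters C (hi k p)))"
proof -
  have "inj_on (\<lambda>k. (lo k p, hi k p)) {..length p}"
    by (rule inj_on_inverseI[where g = "\<lambda>s. length (fst s)"]) (simp add: lo_hi_perms[OF p])
  then show ?thesis
    unfolding coproduct_GG_shuffle[OF p] shuffle_factors[OF p] by (simp add: sum.reindex)
qed

text \<open>Cuts at \<open>j \<le> k\<close> leave the same three blocks of values whichever is made
  first; once the values up to \<open>j\<close> are removed, the other cut sits at
  \<open>k - j\<close>.\<close>

lemma lo_lo: "j \<le> k \<Longrightarrow> lo j (lo k p) = lo j p"
  by (induction p) (auto simp: lo_def)

lemma hi_lo: "j \<le> k \<Longrightarrow> hi j (lo k p) = lo (k - j) (hi j p)"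
  by (induction p) (auto simp: lo_def hi_def)

lemma hi_hi: "hi i (hi j p) = hi (j + i) p"
  by (induction p) (auto simp: hi_def)

lemma lo_hi_bounds:
  assumes "p \<in> colored_perms C"
  shows "lo (length p) p = p" "hi (length p) p = []" "lo 0 p = []" "hi 0 p = p"
proof -
  have "1 \<le> fst s \<and> fst s \<le> length p" if "s \<in> set p" for s
    using colored_perm_letter[OF assms that] by simp
  then show "lo (length p) p = p" "hi (length p) p = []" "lo 0 p = []" "hi 0 p = p"
    by (fastforce simp: lo_def hi_def filter_id_conv filter_empty_conv intro!: map_idI)+
qed

lemma linear_on_span_subspace:
  assumes \<phi>: "linear_on (fun_vs.span B) fscale \<phi>" and S: "fun_vs.subspace S"
    and B: "\<And>b. b \<in> B \<Longrightarrow> \<phi> b \<in> S" and f: "f \<in> fun_vs.span B"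
  shows "\<phi> f \<in> S"
proof -
  have "f \<in> fun_vs.span B \<and> \<phi> f \<in> S"
    using f
  proof (induction rule: fun_vs.span_induct_alt)
    case base
    have "\<phi> 0 = 0" using linear_on_zero[OF \<phi> fun_vs.subspace_span] .
    then show ?case using fun_vs.span_zero fun_vs.subspace_0[OF S] by metis
  next
    case (step c x y)
    have x: "x \<in> fun_vs.span B" using step(1) by (rule fun_vs.span_base)
    then have cx: "fscale c x \<in> fun_vs.span B" by (rule fun_vs.span_scale)
    have "\<phi> (fscale c x + y) = \<phi> (fscale c x) + \<phi> y"
      using \<phi> cx step(2) unfolding linear_on_def by blast
    also have "\<phi> (fscale c x) = fscale c (\<phi> x)" using \<phi> x unfolding linear_on_def by blast
    finally have eq: "\<phi> (fscale c x + y) = fscale c (\<phi> x) + \<phi> y" .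
    have "fscale c (\<phi> x) + \<phi> y \<in> S"
      using B[OF step(1)] step(2) S fun_vs.subspace_add fun_vs.subspace_scale by blast
    moreover have "fscale c x + y \<in> fun_vs.span B" using cx step(2) fun_vs.span_add by blast
    ultimately show ?case unfolding eq by blast
  qed
  then show ?thesis by blast
qed

lemma coproduct_in_tensor_space:
  assumes "f \<in> FQSym C"
  shows "coproduct C f \<in> tensor_space (FQSym C) (FQSym C)"
proof (rule linear_on_span_subspace[OF linear_on_coproduct[unfolded FQSym_def] subspace_tensor_space _
      assms[unfolded FQSym_def]])
  fix b assume "b \<in> GG Letters C ` colored_perms C"
  then obtain p where p: "p \<in> colored_perms C" "b = GG Letters C p" by blast
  show "coproduct C b \<in> tensor_space (FQSym C) (FQSym C)"
    unfolding p(2) coproduct_GG[OF p(1)]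
    by (intro fun_vs.subspace_sum[OF subspace_tensor_space] tens_in_tensor_space GG_in_FQSym
        lo_hi_perms[OF p(1)]) simp_all
qed

lemma coproduct_graded:
  assumes "f \<in> FQSym_hom C n"
  shows "coproduct C f \<in> fun_vs.span (\<Union>i\<le>n. {tens a b | a b. a \<in> FQSym_hom C i \<and> b \<in> FQSym_hom C (n - i)})"
proof (rule linear_on_span_subspace[OF _ fun_vs.subspace_span _ assms[unfolded FQSym_hom_def]])
  have "FQSym_hom C n \<subseteq> FQSym C" using FQSym_hom_iff by blast
  then show "linear_on (fun_vs.span (GG Letters C ` colored_perms_of_size C n)) fscale (coproduct C)"
    using linear_on_coproduct unfolding linear_on_def FQSym_hom_def by blast
  fix b assume "b \<in> GG Letters C ` colored_perms_of_size C n"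
  then obtain p where p: "p \<in> colored_perms_of_size C n" "b = GG Letters C p" by blast
  then have p': "p \<in> colored_perms C" "length p = n"
    by (auto simp: colored_perms_def colored_perms_of_size_iff)
  have "tens (GG Letters C (lo k p)) (GG Letters C (hi k p)) \<in>
      (\<Union>i\<le>n. {tens a b | a b. a \<in> FQSym_hom C i \<and> b \<in> FQSym_hom C (n - i)})" if "k \<le> n" for k
    using lo_colored_perm[OF p(1) that] hi_colored_perm[OF p(1) that] that
    unfolding FQSym_hom_def by (blast intro: fun_vs.span_base)
  then show "coproduct C b \<in> fun_vs.span (\<Union>i\<le>n. {tens a b | a b. a \<in> FQSym_hom C i \<and> b \<in> FQSym_hom C (n - i)})"
    unfolding p(2) coproduct_GG[OF p'(1)] p'(2)
    by (intro fun_vs.span_sum fun_vs.span_base) simp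
qed

section \<open>Multiplicativity of the coproduct\<close>

text \<open>Concatenation in both components, defined for arbitrary functions of pairs of words. It
  is linear in each argument everywhere, so \<open>tlift_linear\<close> can identify it with
  \<open>tensor_mult\<close>.\<close>

definition tword_mult ::
  "(('a, 'c) cword \<times> ('b, 'd) cword \<Rightarrow> 'k::field) \<Rightarrow> (('a, 'c) cword \<times> ('b, 'd) cword \<Rightarrow> 'k) \<Rightarrow>
   ('a, 'c) cword \<times> ('b, 'd) cword \<Rightarrow> 'k" where
  "tword_mult F G = (\<lambda>(x, y). \<Sum>i\<le>length x. \<Sum>j\<le>length y.
     F (take i x, take j y) * G (drop i x, drop j y))"

lemma linear_on_tword_mult:
  "linear_on V fscale (\<lambda>F. tword_mult F G)" "linear_on V fscale (tword_mult F)"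
  by (auto simp: linear_on_def tword_mult_def fun_eq_iff algebra_simps sum.distrib sum_distrib_left)

lemma tword_mult_tens:
  "tword_mult (tens a b) (tens c d) = tens (word_mult a c) (word_mult b d)"
  by (auto simp: tword_mult_def fun_eq_iff word_mult_eq sum_product mult_ac)

lemma tensor_mult_eq:
  assumes "fun_vs.subspace H" "F \<in> tensor_space H H" "G \<in> tensor_space H H"
  shows "tensor_mult H word_mult F G = tword_mult F G"
proof -
  have "tlift H H (\<lambda>c d. tens (word_mult a c) (word_mult b d)) G = tword_mult (tens a b) G" for a b
    using tlift_linear[OF linear_on_tword_mult(2) assms(1,1,3), of "tens a b"]
    by (simp only: tword_mult_tens)
  then show ?thesis
    using tlift_linear[OF linear_on_tword_mult(1) assms(1,1,2), of G]
    unfolding tensor_mult_def by simp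
qed

text \<open>A prefix of a shuffle uses up some \<open>i\<close> letters of \<open>X\<close> and
  \<open>j\<close> of \<open>Y\<close>. It is a shuffle of these two prefixes, and what remains is a
  shuffle of the two suffixes.\<close>

lemma sum_shuffles_cut:
  assumes X: "\<forall>s\<in>set X. P s" and Y: "\<forall>s\<in>set Y. \<not> P s"
  shows "(\<Sum>w\<in>shuffles X Y. \<Sum>i\<le>length w. h (take i w) (drop i w)) =
    (\<Sum>i\<le>length X. \<Sum>j\<le>length Y.
       \<Sum>u\<in>shuffles (take i X) (take j Y). \<Sum>v\<in>shuffles (drop i X) (drop j Y). h u v)"
proof -
  let ?D = "{(u, v). u @ v \<in> shuffles X Y}"
  let ?K = "{..length X} \<times> {..length Y}"
  let ?E = "\<lambda>(i, j). shuffles (take i X) (take j Y) \<times> shuffles (drop i X) (drop j Y)"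
  have iff: "w \<in> shuffles X Y \<longleftrightarrow> filter P w = X \<and> filter (\<lambda>s. \<not> P s) w = Y" for w
    by (rule shuffles_iff_filter[OF X Y])
  have t: "u \<in> shuffles (take i X) (take j Y) \<longleftrightarrow>
      filter P u = take i X \<and> filter (\<lambda>s. \<not> P s) u = take j Y" for u i j
    by (rule shuffles_iff_filter) (use X Y in \<open>blast dest: in_set_takeD\<close>)+
  have d: "u \<in> shuffles (drop i X) (drop j Y) \<longleftrightarrow>
      filter P u = drop i X \<and> filter (\<lambda>s. \<not> P s) u = drop j Y" for u i j
    by (rule shuffles_iff_filter) (use X Y in \<open>blast dest: in_set_dropD\<close>)+
  have D: "?D = (\<Union>k\<in>?K. ?E k)"
  proof (intro equalityI subsetI)
    fix s assume "s \<in> ?D"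
    then obtain u v where s: "s = (u, v)" "filter P u @ filter P v = X"
        "filter (\<lambda>s. \<not> P s) u @ filter (\<lambda>s. \<not> P s) v = Y"
      by (auto simp: iff)
    have "s \<in> ?E (length (filter P u), length (filter (\<lambda>s. \<not> P s) u))"
      by (simp add: s(1) partition_in_shuffles flip: s(2,3))
    moreover have "(length (filter P u), length (filter (\<lambda>s. \<not> P s) u)) \<in> ?K"
      by (simp flip: s(2,3))
    ultimately show "s \<in> (\<Union>k\<in>?K. ?E k)" by blast
  qed (auto simp: iff t d)
  have "(\<Sum>w\<in>shuffles X Y. \<Sum>i\<le>length w. h (take i w) (drop i w)) =
      (\<Sum>(w, i)\<in>(SIGMA w:shuffles X Y. {..length w}). h (take i w) (drop i w))"
    by (simp add: sum.Sigma)
  also have "\<dots> = (\<Sum>(u, v)\<in>?D. h u v)"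
    by (rule sum.reindex_bij_witness[where i = "\<lambda>(u, v). (u @ v, length u)"
          and j = "\<lambda>(w, i). (take i w, drop i w)"]) auto
  also have "\<dots> = (\<Sum>k\<in>?K. \<Sum>(u, v)\<in>?E k. h u v)"
    unfolding D
  proof (rule sum.UNION_disjoint)
    \<comment> \<open>Filtering \<open>u\<close> returns \<open>take i X\<close> and
      \<open>take j Y\<close>, hence \<open>i\<close> and \<open>j\<close>, as these do not exceed
      the lengths of \<open>X\<close> and \<open>Y\<close>.\<close>
    show "\<forall>k\<in>?K. \<forall>l\<in>?K. k \<noteq> l \<longrightarrow> ?E k \<inter> ?E l = {}"
    proof (intro ballI impI)
      fix k l assume kl: "k \<in> ?K" "l \<in> ?K" "k \<noteq> l"
      obtain i j i' j' where "k = (i, j)" "l = (i', j')" by fastforce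
      moreover have "i = i' \<and> j = j'"
        if "take i X = take i' X" "take j Y = take j' Y" "k = (i, j)" "l = (i', j')"
        using that kl(1,2) by (metis SigmaD1 SigmaD2 atMost_iff length_take min_absorb2)
      ultimately show "?E k \<inter> ?E l = {}" using kl(3) by (auto simp: t)
    qed
  qed auto
  also have "\<dots> = (\<Sum>i\<le>length X. \<Sum>j\<le>length Y. \<Sum>(u, v)\<in>?E (i, j). h u v)"
    by (simp add: sum.cartesian_product split_beta)
  finally show ?thesis by (simp add: sum.cartesian_product)
qed

lemma take_copy: "take i (copy b x) = copy b (take i x)" "drop i (copy b x) = copy b (drop i x)"
  by (simp_all add: copy_def take_map drop_map)

lemma length_copy [simp]: "length (copy b x) = length x"
  by (simp add: copy_def)

text \<open>The computation stays with the copies instead of the shifted shuffle: prefixes and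
  suffixes of copies are again copies, whereas factors of a permutation would have to be
  standardized anew.\<close>

lemma coproduct_word_mult:
  assumes C: "finite C" and f: "f \<in> FQSym C" and g: "g \<in> FQSym C"
  shows "coproduct C (word_mult f g) = tword_mult (coproduct C f) (coproduct C g)"
proof
  fix s :: "(nat, 'a) cword \<times> (nat, 'a) cword"
  obtain x y where s: "s = (x, y)" by fastforce
  let ?L = "lists (Letters \<times> C)"
  have fg: "word_mult f g \<in> FQSym C" by (rule word_mult_in_FQSym[OF C f g])
  have L: "z \<in> ?L \<longleftrightarrow> take i z \<in> ?L \<and> drop i z \<in> ?L" for z i
    using append_in_lists_conv[of "take i z" "drop i z"] by simp
  show "coproduct C (word_mult f g) s = tword_mult (coproduct C f) (coproduct C g) s"
  proof (cases "x \<in> ?L \<and> y \<in> ?L")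
    case True
    let ?X = "copy False x" and ?Y = "copy True y"
    have "coproduct C (word_mult f g) s = (\<Sum>w\<in>shuffles ?X ?Y. word_mult f g (cstd w))"
      unfolding s coproduct_eq_copies[OF fg] using True by simp
    also have "\<dots> = (\<Sum>w\<in>shuffles ?X ?Y. \<Sum>i\<le>length w. f (cstd (take i w)) * g (cstd (drop i w)))"
      using True by (intro sum.cong refl word_mult_cstd[OF f g, where B = Letters2])
        (simp only: copies_in_lists)
    also have "\<dots> = (\<Sum>i\<le>length ?X. \<Sum>j\<le>length ?Y. \<Sum>u\<in>shuffles (take i ?X) (take j ?Y).
        \<Sum>v\<in>shuffles (drop i ?X) (drop j ?Y). f (cstd u) * g (cstd v))"
      by (rule sum_shuffles_cut[where P = first_copy]) (auto simp: set_copy first_copy_def)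
    also have "\<dots> = (\<Sum>i\<le>length x. \<Sum>j\<le>length y.
        coproduct C f (take i x, take j y) * coproduct C g (drop i x, drop j y))"
    proof -
      have cf: "coproduct C f (take i x, take j y) =
          (\<Sum>u\<in>shuffles (take i ?X) (take j ?Y). f (cstd u))" for i j
        unfolding coproduct_eq_copies[OF f] take_copy
        by (rule if_P) (use True L[of x i] L[of y j] in blast)
      have cg: "coproduct C g (drop i x, drop j y) =
          (\<Sum>v\<in>shuffles (drop i ?X) (drop j ?Y). g (cstd v))" for i j
        unfolding coproduct_eq_copies[OF g] take_copy
        by (rule if_P) (use True L[of x i] L[of y j] in blast)
      show ?thesis unfolding cf cg sum_product length_copy by (rule refl)
    qed
    finally show ?thesis by (simp add: s tword_mult_def)
  next
    case False
    \<comment> \<open>A letter outside the alphabet falls into one of the two halves of its word and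
      makes the corresponding factor vanish.\<close>
    have "coproduct C f (take i x, take j y) * coproduct C g (drop i x, drop j y) = 0" for i j
    proof -
      have "\<not> (take i x \<in> ?L \<and> take j y \<in> ?L) \<or> \<not> (drop i x \<in> ?L \<and> drop j y \<in> ?L)"
        using False L[of x i] L[of y j] by blast
      then show ?thesis
      proof
        assume "\<not> (take i x \<in> ?L \<and> take j y \<in> ?L)"
        then have "coproduct C f (take i x, take j y) = 0"
          unfolding coproduct_eq_copies[OF f] by (rule if_not_P)
        then show ?thesis by simp
      next
        assume "\<not> (drop i x \<in> ?L \<and> drop j y \<in> ?L)"
        then have "coproduct C g (drop i x, drop j y) = 0"
          unfolding coproduct_eq_copies[OF g] by (rule if_not_P)
        then show ?thesis by simp
      qed
    qed
    then have "tword_mult (coproduct C f) (coproduct C g) s = 0"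
      unfolding tword_mult_def s prod.case by (intro sum.neutral ballI) blast
    moreover have "coproduct C (word_mult f g) s = 0"
      unfolding s coproduct_eq_copies[OF fg] using False by (rule if_not_P)
    ultimately show ?thesis by (simp only:)
  qed
qed

section \<open>Coassociativity and counit\<close>

lemma coproduct_coassoc:
  fixes f :: "(nat, 'c) cword \<Rightarrow> 'k::field"
  assumes "f \<in> FQSym C"
  shows "tensor_map (FQSym C) (FQSym C) (coproduct C) id (coproduct C f) =
    (\<lambda>((x, y), z). tensor_map (FQSym C) (FQSym C) id (coproduct C) (coproduct C f) (x, (y, z)))"
proof (rule linear_on_FQSym_eqI[OF _ _ _ assms])
  let ?H = "FQSym C" and ?\<Delta> = "coproduct C"
    and ?G = "GG Letters C :: _ \<Rightarrow> (nat, 'c) cword \<Rightarrow> 'k"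
  have \<beta>: "bilinear_on ?H ?H fscale (\<lambda>f g. tens (?\<Delta> f) (id g))"
    by (rule bilinear_on_comp[OF bilinear_on_tens linear_on_coproduct linear_on_id(2)])
  have \<gamma>: "bilinear_on ?H ?H fscale (\<lambda>f g. tens (id f) (?\<Delta> g))"
    by (rule bilinear_on_comp[OF bilinear_on_tens linear_on_id(2) linear_on_coproduct])
  show "linear_on ?H fscale (\<lambda>f. tensor_map ?H ?H ?\<Delta> id (?\<Delta> f))"
    unfolding tensor_map_def
    by (rule linear_on_comp[OF linear_on_coproduct coproduct_in_tensor_space
          linear_on_tlift[OF \<beta> subspace_FQSym subspace_FQSym]])
  have "linear_on ?H fscale (\<lambda>f. tensor_map ?H ?H id ?\<Delta> (?\<Delta> f))"
    unfolding tensor_map_def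
    by (rule linear_on_comp[OF linear_on_coproduct coproduct_in_tensor_space
          linear_on_tlift[OF \<gamma> subspace_FQSym subspace_FQSym]])
  then show "linear_on ?H fscale (\<lambda>f. \<lambda>((x, y), z). tensor_map ?H ?H id ?\<Delta> (?\<Delta> f) (x, (y, z)))"
    unfolding linear_on_def by (simp add: fun_eq_iff split_beta)
  fix p assume p: "p \<in> colored_perms C"
  let ?n = "length p"
  note lh = lo_hi_perms[OF p]
  have 1: "tensor_map ?H ?H ?\<Delta> id (?\<Delta> (?G p)) = (\<Sum>k\<le>?n. tens (?\<Delta> (?G (lo k p))) (?G (hi k p)))"
    unfolding tensor_map_def coproduct_GG[OF p]
    using lh by (subst tlift_sum_tens[OF \<beta> subspace_FQSym subspace_FQSym]) (auto intro: GG_in_FQSym)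
  have 2: "tensor_map ?H ?H id ?\<Delta> (?\<Delta> (?G p)) = (\<Sum>k\<le>?n. tens (?G (lo k p)) (?\<Delta> (?G (hi k p))))"
    unfolding tensor_map_def coproduct_GG[OF p]
    using lh by (subst tlift_sum_tens[OF \<gamma> subspace_FQSym subspace_FQSym]) (auto intro: GG_in_FQSym)
  show "tensor_map ?H ?H ?\<Delta> id (?\<Delta> (?G p)) =
      (\<lambda>((x, y), z). tensor_map ?H ?H id ?\<Delta> (?\<Delta> (?G p)) (x, (y, z)))"
  proof
    fix s :: "((nat, 'c) cword \<times> (nat, 'c) cword) \<times> (nat, 'c) cword"
    obtain x y z where s: "s = ((x, y), z)" by (metis prod.collapse)
    \<comment> \<open>The three factors carry the values up to \<open>j\<close>, the next
      \<open>i\<close> values, and the remaining ones.\<close>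
    let ?a = "\<lambda>j i. ?G (lo j p) x * ?G (lo i (hi j p)) y * ?G (hi i (hi j p)) z"
    have "?\<Delta> (?G (lo k p)) (x, y) * ?G (hi k p) z = (\<Sum>j\<le>k. ?a j (k - j))" if "k \<le> ?n" for k
    proof -
      have "?\<Delta> (?G (lo k p)) (x, y) = (\<Sum>j\<le>k. ?G (lo j (lo k p)) x * ?G (hi j (lo k p)) y)"
        using lh[OF that] by (simp add: coproduct_GG sum_fun_apply)
      also have "\<dots> = (\<Sum>j\<le>k. ?G (lo j p) x * ?G (lo (k - j) (hi j p)) y)"
        by (intro sum.cong refl) (simp add: lo_lo hi_lo)
      finally show ?thesis by (simp add: sum_distrib_right hi_hi)
    qed
    then have "tensor_map ?H ?H ?\<Delta> id (?\<Delta> (?G p)) s = (\<Sum>k\<le>?n. \<Sum>j\<le>k. ?a j (k - j))"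
      unfolding 1 s by (simp add: sum_fun_apply)
    also have "\<dots> = (\<Sum>j\<le>?n. \<Sum>i\<le>?n - j. ?a j i)" by (rule sum_atMost_triangle)
    also have "\<dots> = tensor_map ?H ?H id ?\<Delta> (?\<Delta> (?G p)) (x, (y, z))"
      unfolding 2 using lh by (simp add: sum_fun_apply coproduct_GG sum_distrib_left mult.assoc)
    finally show "tensor_map ?H ?H ?\<Delta> id (?\<Delta> (?G p)) s =
        (\<lambda>((x, y), z). tensor_map ?H ?H id ?\<Delta> (?\<Delta> (?G p)) (x, (y, z))) s"
      by (simp add: s)
  qed
qed

lemma copy_Nil [simp]: "copy b [] = []"
  by (simp add: copy_def)

lemma coproduct_Nil:
  assumes f: "f \<in> FQSym C"
  shows "coproduct C f ([], w) = f w" "coproduct C f (w, []) = f w"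
  using FQSym_eq_cstd[OF f, of w] by (simp_all add: coproduct_eq_copies[OF f])

text \<open>Contracting with the counit amounts to putting the empty word into one component, which
  is linear on all functions of pairs; a shuffle with the empty word gives back the other
  word.\<close>

lemma coproduct_counit:
  assumes f: "f \<in> FQSym C"
  shows "tlift (FQSym C) (FQSym C) (\<lambda>a b. fscale (a []) b) (coproduct C f) = f"
    and "tlift (FQSym C) (FQSym C) (\<lambda>a b. fscale (b []) a) (coproduct C f) = f"
proof -
  have "linear_on UNIV fscale (\<lambda>F w. F ([], w))" "linear_on UNIV fscale (\<lambda>F w. F (w, []))"
    by (auto simp: linear_on_def fun_eq_iff)
  from this[THEN tlift_linear[OF _ subspace_FQSym subspace_FQSym coproduct_in_tensor_space[OF f]]]
  show "tlift (FQSym C) (FQSym C) (\<lambda>a b. fscale (a []) b) (coproduct C f) = f"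
    and "tlift (FQSym C) (FQSym C) (\<lambda>a b. fscale (b []) a) (coproduct C f) = f"
    by (simp_all add: coproduct_Nil[OF f] fscale_def mult.commute)
qed

section \<open>The antipode\<close>

text \<open>
  The condition on @length (lo k p)@ only serves termination: it holds for all @k < length p@ if
  @p@ is a colored permutation.
\<close>

function antipode_perm :: "'c set \<Rightarrow> (nat, 'c) cword \<Rightarrow> (nat, 'c) cword \<Rightarrow> 'k::field" where
  "antipode_perm C p = (if p = [] then word_one else
     - (\<Sum>k | k < length p \<and> length (lo k p) < length p.
          word_mult (antipode_perm C (lo k p)) (GG Letters C (hi k p))))"
  by auto
termination by (relation "measure (\<lambda>(C, p). length p)") auto

declare antipode_perm.simps [simp del]

lemma antipode_perm_Nil [simp]: "antipode_perm C [] = word_one"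
  by (simp add: antipode_perm.simps)

lemma antipode_perm_rec:
  assumes "p \<in> colored_perms C" "p \<noteq> []"
  shows "antipode_perm C p =
    - (\<Sum>k<length p. word_mult (antipode_perm C (lo k p)) (GG Letters C (hi k p)))"
proof -
  have "{k. k < length p \<and> length (lo k p) < length p} = {..<length p}"
    using lo_hi_perms(3)[OF assms(1)] by auto
  then show ?thesis using assms(2) by (subst antipode_perm.simps) (simp only: if_False)
qed

lemma antipode_perm_in_FQSym:
  assumes C: "finite C" and "p \<in> colored_perms C"
  shows "(antipode_perm C p :: (nat, 'c) cword \<Rightarrow> 'k::field) \<in> FQSym C"
  using assms(2)
proof (induction "length p" arbitrary: p rule: less_induct)
  case less
  show ?case
  proof (cases "p = []")
    case True
    then show ?thesis by (simp add: word_one_in_FQSym)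
  next
    case False
    have "word_mult (antipode_perm C (lo k p)) (GG Letters C (hi k p) :: (nat, 'c) cword \<Rightarrow> 'k) \<in> FQSym C"
      if "k < length p" for k
      using that lo_hi_perms[OF less.prems, of k]
      by (intro word_mult_in_FQSym[OF C] less.hyps GG_in_FQSym) auto
    then show ?thesis
      unfolding antipode_perm_rec[OF less.prems False]
      by (intro fun_vs.subspace_neg[OF subspace_FQSym] fun_vs.subspace_sum[OF subspace_FQSym]) auto
  qed
qed

text \<open>The term \<open>k = length p\<close> is \<open>antipode_perm C p\<close> itself, because
  there the upper part is empty. The recursion is this identity solved for that term.\<close>

lemma antipode_perm_left:
  assumes p: "p \<in> colored_perms C"
  shows "(\<Sum>k\<le>length p. word_mult (antipode_perm C (lo k p)) (GG Letters C (hi k p))) =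
    (if p = [] then word_one else 0)"
proof (cases "p = []")
  case True
  then show ?thesis by (simp add: lo_def hi_def)
next
  case False
  have "(\<Sum>k\<le>length p. word_mult (antipode_perm C (lo k p)) (GG Letters C (hi k p))) =
      (\<Sum>k<length p. word_mult (antipode_perm C (lo k p)) (GG Letters C (hi k p))) + antipode_perm C p"
    using lo_hi_bounds[OF p] by (simp flip: lessThan_Suc_atMost)
  also have "\<dots> = 0" unfolding antipode_perm_rec[OF p False] by (rule right_minus)
  finally show ?thesis using False by (simp only: if_False)
qed

text \<open>
  Both ways of evaluating the convolution of the left inverse with the identity and with the left
  inverse again must agree; by induction all terms but one of the second evaluation are known.
\<close>

lemma antipode_perm_right:
  fixes C :: "'c set"
  assumes "p \<in> colored_perms C"
  shows "(\<Sum>k\<le>length p. word_mult (GG Letters C (lo k p)) (antipode_perm C (hi k p))) =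
    (if p = [] then word_one else (0 :: (nat, 'c) cword \<Rightarrow> 'k::field))"
  using assms
proof (induction "length p" arbitrary: p rule: less_induct)
  case less
  let ?A = "antipode_perm C :: _ \<Rightarrow> (nat, 'c) cword \<Rightarrow> 'k" and ?G = "GG Letters C :: _ \<Rightarrow> (nat, 'c) cword \<Rightarrow> 'k"
  let ?n = "length p"
  let ?T = "\<lambda>p. \<Sum>k\<le>length p. word_mult (?G (lo k p)) (?A (hi k p))"
  note lh = lo_hi_perms[OF less.prems]
  show ?case
  proof (cases "p = []")
    case True
    then show ?thesis by (simp add: lo_def hi_def)
  next
    case False
    \<comment> \<open>Terms of the threefold convolution of the left inverse, the identity and the
      left inverse, over the three blocks of sizes \<open>j\<close>, \<open>i\<close> and the
      rest.\<close>
    define a where "a j i = word_mult (word_mult (?A (lo j p)) (?G (lo i (hi j p)))) (?A (hi i (hi j p)))" for j i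
    \<comment> \<open>For fixed \<open>k\<close> the left identity applies to \<open>lo k p\<close>,
      so only the empty lower part survives.\<close>
    have "(\<Sum>j\<le>k. a j (k - j)) = (if k = 0 then ?A p else 0)" if k: "k \<le> ?n" for k
    proof -
      have "(\<Sum>j\<le>k. a j (k - j)) =
          word_mult (\<Sum>j\<le>k. word_mult (?A (lo j (lo k p))) (?G (hi j (lo k p)))) (?A (hi k p))"
        unfolding word_mult_sum_left a_def by (intro sum.cong refl) (simp add: lo_lo hi_lo hi_hi)
      also have "\<dots> = word_mult (if lo k p = [] then word_one else 0) (?A (hi k p))"
        unfolding antipode_perm_left[OF lh(1)[OF k], unfolded lh(3)[OF k]] by (rule refl)
      also have "lo k p = [] \<longleftrightarrow> k = 0" using lh(3)[OF k] by auto
      also have "word_mult (if k = 0 then word_one else 0) (?A (hi k p)) = (if k = 0 then ?A p else 0)"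
        using lo_hi_bounds[OF less.prems] by (cases "k = 0") (simp, simp add: word_mult_eq fun_eq_iff)
      finally show ?thesis .
    qed
    then have "(\<Sum>k\<le>?n. \<Sum>j\<le>k. a j (k - j)) = (\<Sum>k\<le>?n. if k = 0 then ?A p else 0)"
      by (intro sum.cong refl) simp
    also have "\<dots> = ?A p" by (simp only: sum.delta' finite_atMost atMost_iff le0 if_True sum.delta)
    finally have 1: "(\<Sum>k\<le>?n. \<Sum>j\<le>k. a j (k - j)) = ?A p" .
    \<comment> \<open>For \<open>j > 0\<close> the induction hypothesis applies to the shorter
      \<open>hi j p\<close> and leaves only \<open>j = ?n\<close>; the term \<open>j = 0\<close> is
      the unknown \<open>?T p\<close>. These two cases are distinct as \<open>p\<close> is
      nonempty.\<close>
    have "(\<Sum>i\<le>?n - j. a j i) = (if j = 0 then ?T p else 0) + (if j = ?n then ?A p else 0)"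
      if j: "j \<le> ?n" for j
    proof -
      have "(\<Sum>i\<le>?n - j. a j i) = word_mult (?A (lo j p)) (?T (hi j p))"
        unfolding word_mult_sum_right a_def word_mult_assoc lh(4)[OF j] by (rule refl)
      also have "\<dots> = (if j = 0 then ?T p else 0) + (if j = ?n then ?A p else 0)"
      proof (cases "j = 0")
        case True
        then show ?thesis using lo_hi_bounds[OF less.prems] False by simp
      next
        case j0: False
        then have "?T (hi j p) = (if hi j p = [] then word_one else 0)"
          using lh[OF j] False by (intro less.hyps) auto
        also have "hi j p = [] \<longleftrightarrow> j = ?n" using lh(4)[OF j] j by auto
        finally have T: "?T (hi j p) = (if j = ?n then word_one else 0)" .
        show ?thesis
        proof (cases "j = ?n")
          case True
          then have "word_mult (?A (lo j p)) (?T (hi j p)) = ?A p"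
            unfolding T using lo_hi_bounds(1)[OF less.prems] by simp
          then show ?thesis using True j0 by simp
        next
          case jn: False
          have "word_mult (?A (lo j p)) (?T (hi j p)) = 0"
            unfolding T using jn by (simp add: word_mult_eq fun_eq_iff)
          then show ?thesis using jn j0 by simp
        qed
      qed
      finally show ?thesis .
    qed
    then have "(\<Sum>j\<le>?n. \<Sum>i\<le>?n - j. a j i) =
        (\<Sum>j\<le>?n. (if j = 0 then ?T p else 0) + (if j = ?n then ?A p else 0))"
      by (intro sum.cong refl) (simp only: atMost_iff)
    also have "\<dots> = ?T p + ?A p"
      unfolding sum.distrib by (simp only: sum.delta finite_atMost atMost_iff le0 order_refl if_True)
    \<comment> \<open>The two evaluations agree, and cancelling \<open>?A p\<close> kills the
      unknown term.\<close>
    finally have "?A p = ?T p + ?A p" using 1 sum_atMost_triangle[of a ?n] by (simp only:)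
    then have "?T p = 0" by (rule add_cancel_right_left[THEN iffD1])
    then show ?thesis using False by (simp only: if_False)
  qed
qed

lemma linear_on_counit_unit:
  "linear_on V fscale (\<lambda>f :: ('a, 'c) cword \<Rightarrow> 'k::field. fscale (f []) word_one)"
  by (auto simp: linear_on_def fun_eq_iff algebra_simps)

lemma GG_at_Nil: "GG Letters C p [] = (if p = [] then 1 else 0)"
  by (simp add: GG_def)

text \<open>Both convolution identities are linear in \<open>f\<close>, so they reduce to the basis,
  where they become \<open>antipode_perm_left\<close> and
  \<open>antipode_perm_right\<close>.\<close>

lemma antipode_FQSym:
  fixes C :: "'c set" and f :: "(nat, 'c) cword \<Rightarrow> 'k::field"
  assumes C: "finite C" and f: "f \<in> FQSym C"
  defines "S \<equiv> basis_extension C (antipode_perm C) :: ((nat, 'c) cword \<Rightarrow> 'k) \<Rightarrow> _"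
  shows "S f \<in> FQSym C"
    and "tlift (FQSym C) (FQSym C) (\<lambda>a b. word_mult (S a) b) (coproduct C f) = fscale (f []) word_one"
    and "tlift (FQSym C) (FQSym C) (\<lambda>a b. word_mult a (S b)) (coproduct C f) = fscale (f []) word_one"
proof -
  let ?H = "FQSym C :: ((nat, 'c) cword \<Rightarrow> 'k) set"
  have S: "linear_on ?H fscale S" unfolding S_def by (rule linear_on_basis_extension)
  have SG: "S (GG Letters C p) = antipode_perm C p" if "p \<in> colored_perms C" for p
    unfolding S_def by (rule basis_extension_GG[OF that])
  show "S f \<in> ?H"
    unfolding S_def basis_extension_def
    by (intro fun_vs.subspace_sum[OF subspace_FQSym] fun_vs.subspace_scale[OF subspace_FQSym]
        antipode_perm_in_FQSym[OF C]) blast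
  have eps: "fscale (GG Letters C p []) word_one = (if p = [] then word_one else (0 :: (nat, 'c) cword \<Rightarrow> 'k))" for p
    by (simp add: GG_at_Nil fun_eq_iff)
  have \<beta>: "bilinear_on ?H ?H fscale (\<lambda>a b. word_mult (S a) b)"
    by (rule bilinear_on_comp[OF bilinear_on_word_mult S linear_on_id(1)])
  show "tlift ?H ?H (\<lambda>a b. word_mult (S a) b) (coproduct C f) = fscale (f []) word_one"
  proof (rule linear_on_FQSym_eqI[OF _ linear_on_counit_unit _ f])
    show "linear_on ?H fscale (\<lambda>f. tlift ?H ?H (\<lambda>a b. word_mult (S a) b) (coproduct C f))"
      by (rule linear_on_comp[OF linear_on_coproduct coproduct_in_tensor_space
            linear_on_tlift[OF \<beta> subspace_FQSym subspace_FQSym]])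
    fix p assume p: "p \<in> colored_perms C"
    note lh = lo_hi_perms[OF p]
    have "tlift ?H ?H (\<lambda>a b. word_mult (S a) b) (coproduct C (GG Letters C p)) =
        (\<Sum>k\<le>length p. word_mult (S (GG Letters C (lo k p))) (GG Letters C (hi k p)))"
      unfolding coproduct_GG[OF p]
      by (rule tlift_sum_tens[OF \<beta> subspace_FQSym subspace_FQSym]) (simp_all add: GG_in_FQSym lh)
    also have "\<dots> = (\<Sum>k\<le>length p. word_mult (antipode_perm C (lo k p)) (GG Letters C (hi k p)))"
      by (intro sum.cong refl) (simp add: SG lh)
    finally show "tlift ?H ?H (\<lambda>a b. word_mult (S a) b) (coproduct C (GG Letters C p)) =
        fscale (GG Letters C p []) word_one"
      unfolding antipode_perm_left[OF p] eps .
  qed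
  have \<gamma>: "bilinear_on ?H ?H fscale (\<lambda>a b. word_mult a (S b))"
    by (rule bilinear_on_comp[OF bilinear_on_word_mult linear_on_id(1) S])
  show "tlift ?H ?H (\<lambda>a b. word_mult a (S b)) (coproduct C f) = fscale (f []) word_one"
  proof (rule linear_on_FQSym_eqI[OF _ linear_on_counit_unit _ f])
    show "linear_on ?H fscale (\<lambda>f. tlift ?H ?H (\<lambda>a b. word_mult a (S b)) (coproduct C f))"
      by (rule linear_on_comp[OF linear_on_coproduct coproduct_in_tensor_space
            linear_on_tlift[OF \<gamma> subspace_FQSym subspace_FQSym]])
    fix p assume p: "p \<in> colored_perms C"
    note lh = lo_hi_perms[OF p]
    have "tlift ?H ?H (\<lambda>a b. word_mult a (S b)) (coproduct C (GG Letters C p)) =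
        (\<Sum>k\<le>length p. word_mult (GG Letters C (lo k p)) (S (GG Letters C (hi k p))))"
      unfolding coproduct_GG[OF p]
      by (rule tlift_sum_tens[OF \<gamma> subspace_FQSym subspace_FQSym]) (simp_all add: GG_in_FQSym lh)
    also have "\<dots> = (\<Sum>k\<le>length p. word_mult (GG Letters C (lo k p)) (antipode_perm C (hi k p)))"
      by (intro sum.cong refl) (simp add: SG lh)
    finally show "tlift ?H ?H (\<lambda>a b. word_mult a (S b)) (coproduct C (GG Letters C p)) =
        fscale (GG Letters C p []) word_one"
      unfolding antipode_perm_right[OF p] eps .
  qed
qed

section \<open>The graded bialgebra and its antipode\<close>

text \<open>The counit is the coefficient of the empty word; it is multiplicative because the empty
  word has only the trivial factorization.\<close>

lemma FQSym_bialgebra: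
  fixes C :: "'c set"
  assumes C: "finite C"
  shows "fun_bialgebra (FQSym C :: ((nat, 'c) cword \<Rightarrow> 'k::field) set)
    word_mult word_one (coproduct C) (\<lambda>f. f [])"
proof unfold_locales
  show "linear_on (FQSym C) (*) (\<lambda>f :: (nat, 'c) cword \<Rightarrow> 'k. f [])"
    by (simp add: linear_on_def)
  show "coproduct C word_one = tens word_one (word_one :: (nat, 'c) cword \<Rightarrow> 'k)"
    using coproduct_GG[of "[]" C] by (simp add: colored_perms_iff colored_perms_of_size_iff lo_def hi_def)
  fix f g :: "(nat, 'c) cword \<Rightarrow> 'k" assume f: "f \<in> FQSym C" and g: "g \<in> FQSym C"
  show "coproduct C (word_mult f g) = tensor_mult (FQSym C) word_mult (coproduct C f) (coproduct C g)"
    using tensor_mult_eq[OF subspace_FQSym coproduct_in_tensor_space[OF f] coproduct_in_tensor_space[OF g]]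
      coproduct_word_mult[OF C f g] by simp
qed (simp_all add: subspace_FQSym word_mult_in_FQSym[OF C] bilinear_on_word_mult word_mult_assoc
    word_one_in_FQSym coproduct_in_tensor_space linear_on_coproduct coproduct_coassoc
    coproduct_counit word_mult_eq word_one_def)

theorem theorem3p3:
  fixes C :: "'c set" and l :: nat
  assumes "finite C" and "card C = l"
  shows
    "(\<exists>counit.
        graded_connected_bialgebra (FQSym C :: ((nat, 'c) cword \<Rightarrow> 'k::field) set) (FQSym_hom C)
          word_mult word_one (coproduct C) counit \<and>
        (\<exists>antipode. fun_Hopf_algebra (FQSym C :: ((nat, 'c) cword \<Rightarrow> 'k) set)
          word_mult word_one (coproduct C) counit antipode)) \<and>
     (\<forall>p \<in> colored_perms C.
        coproduct C (GG Letters C p :: (nat, 'c) cword \<Rightarrow> 'k) =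
          (\<Sum>(p', p'') | p' \<in> colored_perms C \<and> p'' \<in> colored_perms C \<and> p \<in> shifted_shuffle p' p''.
             tens (GG Letters C p') (GG Letters C p'')))"
proof (intro conjI exI ballI)
  let ?H = "FQSym C :: ((nat, 'c) cword \<Rightarrow> 'k) set" and ?\<epsilon> = "\<lambda>f :: (nat, 'c) cword \<Rightarrow> 'k. f []"
  note bialgebra = FQSym_bialgebra[OF assms(1), where 'k = 'k]
  show "graded_connected_bialgebra ?H (FQSym_hom C) word_mult word_one (coproduct C) ?\<epsilon>"
  proof (intro graded_connected_bialgebra.intro[OF bialgebra] graded_connected_bialgebra_axioms.intro)
    fix n
    show "fun_vs.subspace (FQSym_hom C n :: ((nat, 'c) cword \<Rightarrow> 'k) set)"
      unfolding FQSym_hom_def by (rule fun_vs.subspace_span)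
  next
    show "?H = fun_vs.span (\<Union>n. FQSym_hom C n)"
    proof
      have "GG Letters C p \<in> (\<Union>n. FQSym_hom C n)" if "p \<in> colored_perms C" for p
        using that unfolding colored_perms_def FQSym_hom_def by (blast intro: fun_vs.span_base)
      then show "?H \<subseteq> fun_vs.span (\<Union>n. FQSym_hom C n)"
        unfolding FQSym_def by (intro fun_vs.span_mono) blast
      show "fun_vs.span (\<Union>n. FQSym_hom C n) \<subseteq> ?H"
        using FQSym_hom_iff by (intro fun_vs.span_minimal subspace_FQSym) blast
    qed
  next
    fix h :: "nat \<Rightarrow> (nat, 'c) cword \<Rightarrow> 'k" and N n
    assume h: "\<And>n. h n \<in> FQSym_hom C n" and N: "finite N" and z: "(\<Sum>n\<in>N. h n) = 0" and n: "n \<in> N"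
    \<comment> \<open>A homogeneous component lives on the words of its own length, so at a word of
      length \<open>n\<close> the sum reduces to \<open>h n\<close>.\<close>
    have h0: "h m w = 0" if "length w \<noteq> m" for m w
      using h[of m] that unfolding FQSym_hom_iff by blast
    show "h n = 0"
    proof
      fix w
      show "h n w = 0 w"
      proof (cases "length w = n")
        case True
        have "(\<Sum>m\<in>N. h m w) = (\<Sum>m\<in>N. if m = n then h n w else 0)"
          using h0 True by (intro sum.cong) auto
        also have "\<dots> = h n w" using N n by simp
        finally have "h n w = (\<Sum>m\<in>N. h m) w" by (simp add: sum_fun_apply)
        then show ?thesis unfolding z .
      qed (simp add: h0)
    qed
  next
    fix f g :: "(nat, 'c) cword \<Rightarrow> 'k" and m n
    assume f: "f \<in> FQSym_hom C m" and g: "g \<in> FQSym_hom C n"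
    have "length w = m + n" if nz: "word_mult f g w \<noteq> 0" for w
    proof -
      obtain i where "i \<in> {..length w}" "f (take i w) * g (drop i w) \<noteq> 0"
        using sum.not_neutral_contains_not_neutral[OF nz[unfolded word_mult_eq]] .
      then have "i \<le> length w" "length (take i w) = m" "length (drop i w) = n"
        using f g unfolding FQSym_hom_iff by auto
      then show ?thesis by simp
    qed
    then show "word_mult f g \<in> FQSym_hom C (m + n)"
      using f g word_mult_in_FQSym[OF assms(1)] unfolding FQSym_hom_iff by blast
  next
    show "word_one \<in> (FQSym_hom C 0 :: ((nat, 'c) cword \<Rightarrow> 'k) set)"
      unfolding FQSym_hom_iff by (auto simp: word_one_in_FQSym word_one_def)
  next
    fix f :: "(nat, 'c) cword \<Rightarrow> 'k" and n
    assume f: "f \<in> FQSym_hom C n"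
    then show "coproduct C f \<in>
        fun_vs.span (\<Union>i\<le>n. {tens a b | a b. a \<in> FQSym_hom C i \<and> b \<in> FQSym_hom C (n - i)})"
      by (rule coproduct_graded)
    show "f [] = 0" if "n > 0" using f that unfolding FQSym_hom_iff by fastforce
  next
    \<comment> \<open>The only basis element of degree 0 is that of the empty permutation, which is
      the unit.\<close>
    have "colored_perms_of_size C 0 = {[]}" by (auto simp: colored_perms_of_size_iff)
    then show "FQSym_hom C 0 = fun_vs.span {word_one :: (nat, 'c) cword \<Rightarrow> 'k}"
      unfolding FQSym_hom_def by simp
  qed
  show "fun_Hopf_algebra ?H word_mult word_one (coproduct C) ?\<epsilon>
      (basis_extension C (antipode_perm C))"
    by (intro fun_Hopf_algebra.intro[OF bialgebra] fun_Hopf_algebra_axioms.intro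
        antipode_FQSym[OF assms(1)] linear_on_basis_extension)
  show "coproduct C (GG Letters C p :: (nat, 'c) cword \<Rightarrow> 'k) =
      (\<Sum>(p', p'') | p' \<in> colored_perms C \<and> p'' \<in> colored_perms C \<and> p \<in> shifted_shuffle p' p''.
         tens (GG Letters C p') (GG Letters C p''))" if "p \<in> colored_perms C" for p
    by (rule coproduct_GG_shuffle[OF that])
qed

end
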